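(* Let $\Omega\subseteq\mathbb{C}$ be a bounded finitely-connected domain with real analytic boundary, and let $S$ be its (unweighted) Szegő projection. Then $\Omega$ is a disc if and only if $S\bar z$ is constant, i.e. there is a constant $c\in\mathbb{C}$ such that the Szegő projection of the boundary function $z\mapsto\bar z$ on $\partial\Omega$ equals the constant function $c$.
   Context: The Hardy space $H^2(\partial\Omega)$ is the closure in $L^2(\partial\Omega,ds)$ ($ds$ arclength measure, inner product $\langle f,g\rangle=\int_{\partial\Omega}f\bar g\,ds$) of the boundary values of holomorphic functions on $\Omega$ continuous up to $\partial\Omega$. The Szegő projection $S$ is the orthogonal projection of $L^2(\partial\Omega,ds)$ onto $H^2(\partial\Omega)$. *)

theory Defs
  imports "HOL-Analysis.Analysis"
begin

definition real_analytic_fun :: "(real \<Rightarrow> complex) \<Rightarrow> bool" where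
  "real_analytic_fun \<gamma> \<longleftrightarrow>
     (\<forall>t. \<exists>r>0. \<exists>a::nat \<Rightarrow> complex. \<forall>s. \<bar>s - t\<bar> < r \<longrightarrow>
        (\<lambda>n. a n * complex_of_real ((s - t) ^ n)) sums \<gamma> s)"

definition analytic_jordan_curve :: "(real \<Rightarrow> complex) \<Rightarrow> bool" where
  "analytic_jordan_curve \<gamma> \<longleftrightarrow>
     real_analytic_fun \<gamma> \<and> (\<forall>t. \<gamma> (t + 1) = \<gamma> t) \<and> inj_on \<gamma> {0..<1} \<and>
     (\<forall>t. vector_derivative \<gamma> (at t) \<noteq> 0)"

definition bounded_domain :: "complex set \<Rightarrow> bool" where
  "bounded_domain \<Omega> \<longleftrightarrow> open \<Omega> \<and> connected \<Omega> \<and> bounded \<Omega> \<and> \<Omega> \<noteq> {}"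

text \<open>The boundary of \<Omega> is the disjoint union of finitely many regular real-analytic
  Jordan curves (so \<Omega> is finitely connected with real analytic boundary).\<close>
definition analytic_boundary_param :: "complex set \<Rightarrow> (real \<Rightarrow> complex) list \<Rightarrow> bool" where
  "analytic_boundary_param \<Omega> \<gamma>s \<longleftrightarrow>
     \<gamma>s \<noteq> [] \<and> (\<forall>\<gamma>\<in>set \<gamma>s. analytic_jordan_curve \<gamma>) \<and>
     (\<forall>i<length \<gamma>s. \<forall>j<length \<gamma>s. i \<noteq> j \<longrightarrow> (\<gamma>s!i) ` {0..1} \<inter> (\<gamma>s!j) ` {0..1} = {}) \<and>
     frontier \<Omega> = (\<Union>\<gamma>\<in>set \<gamma>s. \<gamma> ` {0..1})"

definition bdry_integral :: "(real \<Rightarrow> complex) list \<Rightarrow> (complex \<Rightarrow> complex) \<Rightarrow> complex" where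
  "bdry_integral \<gamma>s f = (\<Sum>\<gamma>\<leftarrow>\<gamma>s. set_lebesgue_integral lborel {0..1}
       (\<lambda>t. f (\<gamma> t) * complex_of_real (norm (vector_derivative \<gamma> (at t)))))"

definition bdry_norm_sq :: "(real \<Rightarrow> complex) list \<Rightarrow> (complex \<Rightarrow> complex) \<Rightarrow> real" where
  "bdry_norm_sq \<gamma>s g = (\<Sum>\<gamma>\<leftarrow>\<gamma>s. set_lebesgue_integral lborel {0..1}
       (\<lambda>t. (norm (g (\<gamma> t)))\<^sup>2 * norm (vector_derivative \<gamma> (at t))))"

definition bdry_L2 :: "(real \<Rightarrow> complex) list \<Rightarrow> (complex \<Rightarrow> complex) \<Rightarrow> bool" where
  "bdry_L2 \<gamma>s g \<longleftrightarrow> (\<forall>\<gamma>\<in>set \<gamma>s.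
      set_borel_measurable lborel {0..1} (\<lambda>t. g (\<gamma> t)) \<and>
      set_integrable lborel {0..1} (\<lambda>t. (norm (g (\<gamma> t)))\<^sup>2 * norm (vector_derivative \<gamma> (at t))))"

definition bdry_inner :: "(real \<Rightarrow> complex) list \<Rightarrow> (complex \<Rightarrow> complex) \<Rightarrow> (complex \<Rightarrow> complex) \<Rightarrow> complex" where
  "bdry_inner \<gamma>s f g = bdry_integral \<gamma>s (\<lambda>z. f z * cnj (g z))"

definition hardy_space :: "complex set \<Rightarrow> (real \<Rightarrow> complex) list \<Rightarrow> (complex \<Rightarrow> complex) set" where
  "hardy_space \<Omega> \<gamma>s = {g. bdry_L2 \<gamma>s g \<and>
      (\<forall>e>0. \<exists>F. F holomorphic_on \<Omega> \<and> continuous_on (closure \<Omega>) F \<and>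
                 bdry_norm_sq \<gamma>s (\<lambda>z. g z - F z) < e)}"

text \<open>"S f = g": g is the orthogonal projection of f onto the Hardy space
  (equality in L^2, i.e. the defining property of the orthogonal projection).\<close>
definition is_szego_projection ::
  "complex set \<Rightarrow> (real \<Rightarrow> complex) list \<Rightarrow> (complex \<Rightarrow> complex) \<Rightarrow> (complex \<Rightarrow> complex) \<Rightarrow> bool" where
  "is_szego_projection \<Omega> \<gamma>s f g \<longleftrightarrow>
     g \<in> hardy_space \<Omega> \<gamma>s \<and>
     (\<forall>h\<in>hardy_space \<Omega> \<gamma>s. bdry_inner \<gamma>s (\<lambda>z. f z - g z) h = 0)"

end

theory Submission
  imports Defs "HOL-Complex_Analysis.Complex_Analysis"
begin

text \<open>
  Suppose the projection is a constant and let \<open>z0\<close> be its conjugate. Then \<open>(z - z0) ds\<close> annihilates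
  every \<open>h\<close> in the Hardy space. For \<open>h = 1 / (z - a)\<close> with \<open>a\<close> off the closure of \<open>\<Omega>\<close>, the real part
  of this says that the length \<open>L\<close> of the boundary equals
  \<open>\<integral> (|a - z0|\<^sup>2 - |z - z0|\<^sup>2) / |z - a|\<^sup>2 ds\<close>. Let \<open>r\<close> be the distance from \<open>z0\<close> to the boundary and
  let \<open>a\<close> tend, along the normal, to a boundary point nearest to \<open>z0\<close>: only a neighbourhood of that
  point contributes, like the Poisson kernel of a half plane, and \<open>L \<le> 2 \<pi> r\<close> results. In particular
  \<open>z0\<close> lies in \<open>\<Omega>\<close>, hence inside one of the boundary curves \<open>\<gamma>\<close>, and the winding number gives
  \<open>2 \<pi> \<le> \<integral>\<^sub>\<gamma> ds / |z - z0| \<le> L / r\<close>. Equality throughout forces \<open>\<gamma>\<close> to be the whole boundary and to lie on the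
  circle of radius \<open>r\<close> about \<open>z0\<close>.

  Conversely, \<open>(z - z0) ds\<close> is a constant multiple of \<open>dz\<close> on a circle about \<open>z0\<close>, so Cauchy's theorem
  makes it annihilate the Hardy space of the disc.
\<close>

subsection \<open>Analytic Jordan curves\<close>

abbreviation velocity :: "(real \<Rightarrow> complex) \<Rightarrow> real \<Rightarrow> complex" where
  "velocity \<gamma> t \<equiv> vector_derivative \<gamma> (at t)"

abbreviation speed :: "(real \<Rightarrow> complex) \<Rightarrow> real \<Rightarrow> real" where
  "speed \<gamma> t \<equiv> norm (velocity \<gamma> t)"

abbreviation curve_length :: "(real \<Rightarrow> complex) \<Rightarrow> real" where
  "curve_length \<gamma> \<equiv> integral {0..1} (speed \<gamma>)"

text \<open>The power series at \<open>t\<close> converges on a complex disc of the same radius, so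
  near \<open>t\<close> the curve is a holomorphic function restricted to the real axis, and the
  complex derivative is continuous. All the C1 regularity used below comes from here.\<close>

lemma real_analytic_fun_local_derivative:
  assumes "real_analytic_fun \<gamma>"
  obtains r D where "r > 0" "continuous_on {t - r<..<t + r} D"
    "\<And>s. s \<in> {t - r<..<t + r} \<Longrightarrow> (\<gamma> has_vector_derivative D s) (at s)"
proof -
  obtain r a where r: "r > 0"
    and sums: "\<And>s. \<bar>s - t\<bar> < r \<Longrightarrow> (\<lambda>n. a n * complex_of_real ((s - t) ^ n)) sums \<gamma> s"
    using assms unfolding real_analytic_fun_def by metis
  define F where "F = (\<lambda>z::complex. \<Sum>n. a n * z ^ n)"
  define F' where "F' = (\<lambda>z::complex. \<Sum>n. diffs a n * z ^ n)"
  have summ: "summable (\<lambda>n. a n * z ^ n)" if z: "norm z < r" for z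
  proof -
    obtain x where x: "norm z < x" "x < r" using dense[of "norm z" r] z by auto
    hence "x > 0" using norm_ge_zero[of z] by linarith
    hence "summable (\<lambda>n. a n * complex_of_real x ^ n)"
      using sums[of "t + x"] x by (auto simp: sums_iff)
    thus ?thesis by (rule powser_inside[of a "complex_of_real x"]) (use x \<open>x > 0\<close> in auto)
  qed
  have dF: "(F has_field_derivative F' z) (at z)" if "norm z < r" for z
    unfolding F_def F'_def by (rule termdiffs_strong'[where K = r]) (use summ that in auto)
  have eq: "\<gamma> s = F (of_real (s - t))" if "\<bar>s - t\<bar> < r" for s
    using sums_unique[OF sums[OF that]] by (simp only: F_def of_real_power)
  have "F holomorphic_on ball 0 r"
    unfolding holomorphic_on_open[OF open_ball] using dF by (metis mem_ball_0)
  hence "deriv F holomorphic_on ball 0 r" by (simp add: holomorphic_deriv)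
  hence "continuous_on (ball 0 r) (deriv F)" by (rule holomorphic_on_imp_continuous_on)
  hence contF': "continuous_on (ball 0 r) F'"
  proof (rule continuous_on_eq)
    show "deriv F z = F' z" if "z \<in> ball 0 r" for z
      using dF[of z] that by (intro DERIV_imp_deriv) simp
  qed
  define D where "D = (\<lambda>s. F' (of_real (s - t)))"
  have contD: "continuous_on {t - r<..<t + r} D"
    unfolding D_def
  proof (rule continuous_on_compose2[OF contF'])
    show "continuous_on {t - r<..<t + r} (\<lambda>s. complex_of_real (s - t))"
      by (intro continuous_intros)
    show "(\<lambda>s. complex_of_real (s - t)) ` {t - r<..<t + r} \<subseteq> ball 0 r"
      by (auto simp: abs_less_iff simp del: of_real_diff)
  qed
  have "(\<gamma> has_vector_derivative D s) (at s)" if s: "s \<in> {t - r<..<t + r}" for s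
  proof -
    have "norm (of_real s - of_real t :: complex) < r"
      using s by (simp add: abs_less_iff flip: of_real_diff)
    from dF[OF this] have "((\<lambda>z. F (z - of_real t)) has_field_derivative F' (of_real s - of_real t) * 1) (at (of_real s))"
      by (rule DERIV_chain2) (auto intro!: derivative_eq_intros)
    hence "((\<lambda>x. F (of_real x - of_real t)) has_vector_derivative D s) (at s)"
      unfolding D_def of_real_diff mult_1_right by (rule has_vector_derivative_real_field)
    thus ?thesis
      by (rule has_vector_derivative_transform_within_open[of _ _ _ "{t - r<..<t + r}"])
         (use s in \<open>auto simp: eq abs_less_iff\<close>)
  qed
  from that[OF r contD this] show ?thesis .
qed

lemma analytic_jordan_curve_has_velocity:
  assumes "analytic_jordan_curve \<gamma>"
  shows "(\<gamma> has_vector_derivative velocity \<gamma> t) (at t)"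
proof -
  obtain r D where "r > 0" "\<And>s. s \<in> {t - r<..<t + r} \<Longrightarrow> (\<gamma> has_vector_derivative D s) (at s)"
    using assms real_analytic_fun_local_derivative analytic_jordan_curve_def by metis
  hence "(\<gamma> has_vector_derivative D t) (at t)" by auto
  thus ?thesis using vector_derivative_works differentiableI_vector by blast
qed

lemma analytic_jordan_curve_continuous:
  assumes "analytic_jordan_curve \<gamma>"
  shows "continuous_on A \<gamma>"
  by (meson analytic_jordan_curve_has_velocity assms continuous_at_imp_continuous_on
      has_vector_derivative_continuous)

lemma analytic_jordan_curve_continuous_velocity:
  assumes "analytic_jordan_curve \<gamma>"
  shows "continuous_on A (velocity \<gamma>)"
proof (intro continuous_at_imp_continuous_on ballI)
  fix t
  obtain r D where r: "r > 0" "continuous_on {t - r<..<t + r} D"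
     "\<And>s. s \<in> {t - r<..<t + r} \<Longrightarrow> (\<gamma> has_vector_derivative D s) (at s)"
    using assms real_analytic_fun_local_derivative analytic_jordan_curve_def by metis
  have "continuous_on {t - r<..<t + r} (velocity \<gamma>)"
    using r(2) by (rule continuous_on_eq) (use r(3) vector_derivative_at in metis)
  thus "isCont (velocity \<gamma>) t"
    using r(1) by (simp add: continuous_on_eq_continuous_at)
qed

text \<open>In composed form, these let continuity goals about any expression in
  \<open>\<gamma>\<close> and its velocity reduce to the single fact that \<open>\<gamma>\<close> is
  an analytic Jordan curve.\<close>

lemmas analytic_jordan_curve_cont [continuous_intros] =
  continuous_on_compose2[OF analytic_jordan_curve_continuous _ subset_UNIV]
  continuous_on_compose2[OF analytic_jordan_curve_continuous_velocity _ subset_UNIV]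

lemma analytic_jordan_curve_speed_pos:
  "analytic_jordan_curve \<gamma> \<Longrightarrow> speed \<gamma> t > 0"
  by (simp add: analytic_jordan_curve_def)

section \<open>Periodicity and injectivity modulo one\<close>

lemma analytic_jordan_curve_period: "analytic_jordan_curve \<gamma> \<Longrightarrow> \<gamma> (t + 1) = \<gamma> t"
  by (simp add: analytic_jordan_curve_def)

lemma analytic_jordan_curve_velocity_period:
  assumes "analytic_jordan_curve \<gamma>"
  shows "velocity \<gamma> (t + 1) = velocity \<gamma> t"
proof -
  have *: "((\<lambda>s::real. s + 1) has_vector_derivative 1) (at t)"
    by (auto simp: has_vector_derivative_def intro!: derivative_eq_intros)
  have "((\<lambda>s. \<gamma> (s + 1)) has_vector_derivative velocity \<gamma> (t + 1)) (at t)"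
    using vector_diff_chain_at[OF *, of \<gamma> "velocity \<gamma> (t + 1)"]
      analytic_jordan_curve_has_velocity[OF assms, of "t + 1"] by (simp add: o_def)
  thus ?thesis
    by (simp add: analytic_jordan_curve_period[OF assms] vector_derivative_at)
qed

lemma analytic_jordan_curve_period_int:
  assumes "analytic_jordan_curve \<gamma>"
  shows "\<gamma> (t + of_int n) = \<gamma> t"
proof (induction n)
  case (nonneg n)
  show ?case
  proof (induction n)
    case (Suc n)
    thus ?case using analytic_jordan_curve_period[OF assms, of "t + real n"] by (simp add: add_ac)
  qed simp
next
  case (neg n)
  show ?case
  proof (induction n)
    case 0
    thus ?case using analytic_jordan_curve_period[OF assms, of "t - 1"] by simp
  next
    case (Suc n)
    thus ?case using analytic_jordan_curve_period[OF assms, of "t - real n - 2"] by (simp add: algebra_simps)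
  qed
qed

text \<open>Parameters range over the whole real line so that windows may be centred anywhere; the
  fractional part leads back to the period on which the boundary is described.\<close>

lemma analytic_jordan_curve_mem:
  assumes "analytic_jordan_curve \<gamma>"
  shows "\<gamma> t \<in> \<gamma> ` {0..1}"
proof
  show "\<gamma> t = \<gamma> (frac t)"
    using analytic_jordan_curve_period_int[OF assms, of t "- \<lfloor>t\<rfloor>"] by (simp add: frac_def)
  show "frac t \<in> {0..1}" using frac_lt_1[of t] by (auto simp: less_imp_le)
qed

lemma analytic_jordan_curve_paths:
  assumes "analytic_jordan_curve \<gamma>"
  shows "valid_path \<gamma>" "simple_path \<gamma>" "pathfinish \<gamma> = pathstart \<gamma>"
proof -
  have C1: "\<gamma> C1_differentiable_on {0..1}"
    unfolding C1_differentiable_on_def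
    using analytic_jordan_curve_has_velocity[OF assms]
      analytic_jordan_curve_continuous_velocity[OF assms] by (intro exI[of _ "velocity \<gamma>"]) auto
  thus "valid_path \<gamma>"
    by (simp add: valid_path_def C1_differentiable_imp_piecewise)
  have "\<gamma> 1 = \<gamma> 0" using analytic_jordan_curve_period[OF assms, of 0] by simp
  thus "pathfinish \<gamma> = pathstart \<gamma>" by (simp add: pathfinish_def pathstart_def)
  have inj: "inj_on \<gamma> {0..<1}" using assms by (simp add: analytic_jordan_curve_def)
  have "loop_free \<gamma>"
    unfolding loop_free_def
  proof (intro ballI impI)
    fix x y :: real assume xy: "x \<in> {0..1}" "y \<in> {0..1}" "\<gamma> x = \<gamma> y"
    show "x = y \<or> x = 0 \<and> y = 1 \<or> x = 1 \<and> y = 0"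
    proof (cases "x = 1"; cases "y = 1")
      assume "x = 1" "y \<noteq> 1"
      thus ?thesis using xy \<open>\<gamma> 1 = \<gamma> 0\<close> inj_onD[OF inj, of 0 y] by auto
    next
      assume "x \<noteq> 1" "y = 1"
      thus ?thesis using xy \<open>\<gamma> 1 = \<gamma> 0\<close> inj_onD[OF inj, of x 0] by auto
    next
      assume "x \<noteq> 1" "y \<noteq> 1"
      thus ?thesis using xy inj_onD[OF inj, of x y] by auto
    qed auto
  qed
  thus "simple_path \<gamma>"
    by (simp add: simple_path_def path_def analytic_jordan_curve_continuous[OF assms])
qed

text \<open>For \<open>c\<close> in the unit interval a single piece, over
  \<open>{1..c + 1}\<close>, has to be moved by one period. This restriction is why nearest points
  are later given parameters between 1/2 and 3/2.\<close>

lemma integral_unit_periodic: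
  fixes f :: "real \<Rightarrow> real"
  assumes "continuous_on UNIV f" "\<And>t. f (t + 1) = f t" "0 \<le> c" "c \<le> 1"
  shows "integral {c..c + 1} f = integral {0..1} f"
proof -
  have int: "f integrable_on {u..v}" for u v
    using assms(1) continuous_on_subset by (blast intro: integrable_continuous_interval)
  have "((f \<circ> (+) 1) has_integral integral {0..c} f) {0..c}"
    using int[of 0 c] assms(2) by (simp add: o_def add.commute has_integral_integral)
  hence "integral {1..c + 1} f = integral {0..c} f"
    by (simp add: has_integral_shift_Icc_real integral_unique)
  moreover have "integral {c..1} f + integral {1..c + 1} f = integral {c..c + 1} f"
    using assms by (intro Henstock_Kurzweil_Integration.integral_combine int) auto
  moreover have "integral {0..c} f + integral {c..1} f = integral {0..1} f"
    using assms by (intro Henstock_Kurzweil_Integration.integral_combine int) auto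
  ultimately show ?thesis by simp
qed

lemma set_lebesgue_integral_continuous:
  fixes f :: "real \<Rightarrow> 'a::euclidean_space"
  assumes "continuous_on {a..b} f"
  shows "set_lebesgue_integral lborel {a..b} f = integral {a..b} f"
  using assms by (intro set_borel_integral_eq_integral borel_integrable_atLeastAtMost')

text \<open>Equal values force equal fractional parts, so \<open>s\<close> and \<open>t\<close>
  differ by an integer, and an integer of modulus below one is zero.\<close>

lemma analytic_jordan_curve_inj:
  assumes "analytic_jordan_curve \<gamma>" "\<gamma> s = \<gamma> t" "\<bar>s - t\<bar> < 1"
  shows "s = t"
proof -
  have fr: "\<gamma> x = \<gamma> (frac x)" "frac x \<in> {0..<1}" for x
    using analytic_jordan_curve_period_int[OF assms(1), of x "- \<lfloor>x\<rfloor>"] frac_lt_1[of x]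
    by (auto simp: frac_def)
  have "inj_on \<gamma> {0..<1}" using assms(1) by (simp add: analytic_jordan_curve_def)
  hence "frac s = frac t" using fr assms(2) by (metis inj_onD)
  hence "s - t = of_int (\<lfloor>s\<rfloor> - \<lfloor>t\<rfloor>)" by (simp add: frac_def)
  moreover from this have "\<bar>\<lfloor>s\<rfloor> - \<lfloor>t\<rfloor>\<bar> < 1" using assms(3) by linarith
  ultimately show ?thesis by simp
qed

lemma analytic_jordan_curve_centered:
  assumes "analytic_jordan_curve \<gamma>"
  shows "\<exists>s. \<bar>s - t1\<bar> \<le> 1/2 \<and> \<gamma> s = \<gamma> t"
proof (intro exI conjI)
  define k where "k = \<lfloor>t - (t1 - 1/2)\<rfloor>"
  have "of_int k \<le> t - (t1 - 1/2)" "t - (t1 - 1/2) < of_int k + 1"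
    unfolding k_def by linarith+
  thus "\<bar>t + of_int (- k) - t1\<bar> \<le> 1/2" unfolding abs_le_iff of_int_minus by linarith
  show "\<gamma> (t + of_int (- k)) = \<gamma> t" by (rule analytic_jordan_curve_period_int[OF assms])
qed

subsection \<open>Mass of the Poisson-type kernel near a boundary point\<close>

lemma orthogonal_norm_squared:
  fixes u v :: "'a::real_inner"
  assumes "inner u v = 0"
  shows "(norm (a *\<^sub>R u - b *\<^sub>R v))\<^sup>2 = a\<^sup>2 * (norm u)\<^sup>2 + b\<^sup>2 * (norm v)\<^sup>2"
  using assms unfolding power2_norm_eq_inner
  by (simp add: inner_diff_left inner_diff_right inner_commute[of v u] power2_eq_square)

text \<open>For a straight line traversed at speed \<open>g\<close> the integral of
  \<open>g / (g\<^sup>2 * x\<^sup>2 + \<sigma>\<^sup>2)\<close> over all real \<open>x\<close> is pi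
  divided by the modulus of \<open>\<sigma>\<close>. Close to \<open>t1\<close> the curve differs
  from its tangent line by a small relative error, which is absorbed in the factor
  \<open>\<kappa>\<close>.\<close>

lemma local_poisson_mass_bound:
  assumes \<gamma>: "analytic_jordan_curve \<gamma>" and n: "norm n = 1" "inner n (velocity \<gamma> t1) = 0"
    and \<kappa>: "\<kappa> > 1"
  obtains \<delta> where "0 < \<delta>" "\<delta> < 1/2"
    "\<And>\<sigma> t. \<sigma> \<noteq> 0 \<Longrightarrow> \<bar>t - t1\<bar> \<le> \<delta> \<Longrightarrow> \<gamma> t \<noteq> \<gamma> t1 + \<sigma> *\<^sub>R n"
    "\<And>\<sigma>. \<sigma> \<noteq> 0 \<Longrightarrow> integral {t1 - \<delta>..t1 + \<delta>}
        (\<lambda>t. speed \<gamma> t / (norm (\<gamma> t - (\<gamma> t1 + \<sigma> *\<^sub>R n)))\<^sup>2) \<le> \<kappa> * pi / \<bar>\<sigma>\<bar>"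
proof -
  define g where "g = speed \<gamma> t1"
  have g: "g > 0" using analytic_jordan_curve_speed_pos[OF \<gamma>] by (simp add: g_def)
  \<comment> \<open>The relative error allowed in both position and speed. It solves
    \<open>1 + \<eta> = \<kappa> * (1 - 2 * \<eta>)\<close>, which bounds the total loss
    \<open>(1 + \<eta>) / (1 - \<eta>)\<^sup>2\<close> by \<open>\<kappa>\<close>.\<close>
  define \<eta> where "\<eta> = (\<kappa> - 1) / (1 + 2 * \<kappa>)"
  have \<eta>: "0 < \<eta>" "\<eta> < 1" using \<kappa> by (auto simp: \<eta>_def)
  have "(1 + \<eta>) = \<kappa> * (1 - 2 * \<eta>)" using \<kappa> by (simp add: \<eta>_def field_simps)
  also have "\<dots> \<le> \<kappa> * (1 - \<eta>)\<^sup>2"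
    using \<kappa> by (intro mult_left_mono) (auto simp: power2_eq_square algebra_simps)
  finally have \<eta>\<kappa>: "1 + \<eta> \<le> \<kappa> * (1 - \<eta>)\<^sup>2" .
  have "(\<gamma> has_derivative (\<lambda>h. h *\<^sub>R velocity \<gamma> t1)) (at t1)"
    using analytic_jordan_curve_has_velocity[OF \<gamma>, of t1] by (simp add: has_vector_derivative_def)
  moreover have "\<eta> * g > 0" using \<eta> g by simp
  ultimately obtain d1 where d1: "d1 > 0"
    "\<And>t. \<bar>t - t1\<bar> < d1 \<Longrightarrow> norm (\<gamma> t - \<gamma> t1 - (t - t1) *\<^sub>R velocity \<gamma> t1) \<le> \<eta> * g * \<bar>t - t1\<bar>"
    unfolding has_derivative_at_alt real_norm_def by blast
  have "isCont (speed \<gamma>) t1"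
    using analytic_jordan_curve_continuous_velocity[OF \<gamma>, of UNIV]
    by (auto simp: continuous_on_eq_continuous_at intro!: continuous_intros)
  then obtain d2 where d2: "d2 > 0" "\<And>t. \<bar>t - t1\<bar> < d2 \<Longrightarrow> \<bar>speed \<gamma> t - g\<bar> < \<eta> * g"
    using \<open>\<eta> * g > 0\<close> unfolding continuous_at_eps_delta g_def dist_real_def by blast
  define \<delta> where "\<delta> = min (min d1 d2) (1/2) / 2"
  have \<delta>: "0 < \<delta>" "\<delta> < 1/2" "\<delta> < d1" "\<delta> < d2" using d1 d2 by (auto simp: \<delta>_def)
  \<comment> \<open>By Pythagoras, the squared distance from the pole
    \<open>\<gamma> t1 + \<sigma> *\<^sub>R n\<close> to the point of the tangent line with
    parameter \<open>t\<close>.\<close>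
  define q where "q = (\<lambda>\<sigma> t. g\<^sup>2 * (t - t1)\<^sup>2 + \<sigma>\<^sup>2)"
  have qpos: "q \<sigma> t > 0" if "\<sigma> \<noteq> 0" for \<sigma> t
    unfolding q_def using that by (intro add_nonneg_pos) auto
  have lower: "(1 - \<eta>)\<^sup>2 * q \<sigma> t \<le> (norm (\<gamma> t - (\<gamma> t1 + \<sigma> *\<^sub>R n)))\<^sup>2"
    if t: "\<bar>t - t1\<bar> \<le> \<delta>" for \<sigma> t
  proof -
    have Q: "norm ((t - t1) *\<^sub>R velocity \<gamma> t1 - \<sigma> *\<^sub>R n) = sqrt (q \<sigma> t)"
      using orthogonal_norm_squared[of "velocity \<gamma> t1" n "t - t1" \<sigma>] n
      by (simp add: q_def g_def inner_commute real_sqrt_unique mult.commute)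
    have "g * \<bar>t - t1\<bar> = sqrt (g\<^sup>2 * (t - t1)\<^sup>2)" using g by (simp add: real_sqrt_mult)
    also have "\<dots> \<le> sqrt (q \<sigma> t)" by (simp add: q_def)
    finally have le: "g * \<bar>t - t1\<bar> \<le> sqrt (q \<sigma> t)" .
    have "sqrt (q \<sigma> t) \<le> norm (\<gamma> t - (\<gamma> t1 + \<sigma> *\<^sub>R n)) + norm (\<gamma> t - \<gamma> t1 - (t - t1) *\<^sub>R velocity \<gamma> t1)"
      unfolding Q[symmetric]
      using norm_triangle_ineq4[of "\<gamma> t - (\<gamma> t1 + \<sigma> *\<^sub>R n)" "\<gamma> t - \<gamma> t1 - (t - t1) *\<^sub>R velocity \<gamma> t1"]
      by (simp add: algebra_simps)
    also have "norm (\<gamma> t - \<gamma> t1 - (t - t1) *\<^sub>R velocity \<gamma> t1) \<le> \<eta> * (g * \<bar>t - t1\<bar>)"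
      using d1(2)[of t] t \<delta> by (simp add: mult.assoc)
    also have "\<dots> \<le> \<eta> * sqrt (q \<sigma> t)" using le \<eta> by (intro mult_left_mono) auto
    finally have "(1 - \<eta>) * sqrt (q \<sigma> t) \<le> norm (\<gamma> t - (\<gamma> t1 + \<sigma> *\<^sub>R n))"
      by (simp add: algebra_simps)
    hence "((1 - \<eta>) * sqrt (q \<sigma> t))\<^sup>2 \<le> (norm (\<gamma> t - (\<gamma> t1 + \<sigma> *\<^sub>R n)))\<^sup>2"
      using \<eta> by (intro power_mono) (auto simp: q_def)
    thus ?thesis by (simp add: power_mult_distrib q_def)
  qed
  have ne: "\<gamma> t \<noteq> \<gamma> t1 + \<sigma> *\<^sub>R n" if "\<sigma> \<noteq> 0" "\<bar>t - t1\<bar> \<le> \<delta>" for \<sigma> t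
  proof
    assume "\<gamma> t = \<gamma> t1 + \<sigma> *\<^sub>R n"
    hence "(1 - \<eta>)\<^sup>2 * q \<sigma> t \<le> 0" using lower[OF that(2), of \<sigma>] by simp
    moreover have "(1 - \<eta>)\<^sup>2 * q \<sigma> t > 0" using \<eta> qpos[OF that(1)] by simp
    ultimately show False by simp
  qed
  have "integral {t1 - \<delta>..t1 + \<delta>} (\<lambda>t. speed \<gamma> t / (norm (\<gamma> t - (\<gamma> t1 + \<sigma> *\<^sub>R n)))\<^sup>2) \<le> \<kappa> * pi / \<bar>\<sigma>\<bar>"
    if \<sigma>: "\<sigma> \<noteq> 0" for \<sigma>
  proof -
    define s where "s = \<bar>\<sigma>\<bar>"
    have s: "s > 0" using \<sigma> by (simp add: s_def)
    \<comment> \<open>An antiderivative of the comparison kernel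
      \<open>\<kappa> * g / q \<sigma> t\<close>; since arctan has total variation pi, its increment
      is at most \<open>\<kappa> * pi / s\<close> on every interval.\<close>
    define A where "A = (\<lambda>t. \<kappa> / s * arctan (g / s * (t - t1)))"
    have dA: "(A has_vector_derivative \<kappa> * g / q \<sigma> t) (at t within {t1 - \<delta>..t1 + \<delta>})" for t
    proof -
      have "(A has_real_derivative \<kappa> / s * (inverse (1 + (g / s * (t - t1))\<^sup>2) * (g / s)))
            (at t within {t1 - \<delta>..t1 + \<delta>})"
        unfolding A_def using s by (auto intro!: derivative_eq_intros)
      also have "1 + (g / s * (t - t1))\<^sup>2 = q \<sigma> t / (s * s)"
        using s by (simp add: q_def s_def field_simps power2_eq_square)
      also have "\<kappa> / s * (inverse (q \<sigma> t / (s * s)) * (g / s)) = \<kappa> * g / q \<sigma> t"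
        using s qpos[OF \<sigma>, of t] by (simp add: field_simps)
      finally show ?thesis by (simp add: has_real_derivative_iff_has_vector_derivative)
    qed
    have I: "((\<lambda>t. \<kappa> * g / q \<sigma> t) has_integral A (t1 + \<delta>) - A (t1 - \<delta>)) {t1 - \<delta>..t1 + \<delta>}"
      using \<delta> dA by (intro fundamental_theorem_of_calculus) auto
    have "integral {t1 - \<delta>..t1 + \<delta>} (\<lambda>t. speed \<gamma> t / (norm (\<gamma> t - (\<gamma> t1 + \<sigma> *\<^sub>R n)))\<^sup>2)
          \<le> integral {t1 - \<delta>..t1 + \<delta>} (\<lambda>t. \<kappa> * g / q \<sigma> t)"
    proof (rule integral_le)
      show "(\<lambda>t. speed \<gamma> t / (norm (\<gamma> t - (\<gamma> t1 + \<sigma> *\<^sub>R n)))\<^sup>2) integrable_on {t1 - \<delta>..t1 + \<delta>}"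
        using ne[OF \<sigma>] by (intro integrable_continuous_interval continuous_intros \<gamma>)
          (auto simp: abs_le_iff)
      show "(\<lambda>t. \<kappa> * g / q \<sigma> t) integrable_on {t1 - \<delta>..t1 + \<delta>}" using I by blast
      fix t assume "t \<in> {t1 - \<delta>..t1 + \<delta>}"
      hence t: "\<bar>t - t1\<bar> \<le> \<delta>" by auto
      have "speed \<gamma> t \<le> (1 + \<eta>) * g" using d2(2)[of t] t \<delta> by (simp add: algebra_simps)
      also have "\<dots> \<le> \<kappa> * (1 - \<eta>)\<^sup>2 * g" using \<eta>\<kappa> g by simp
      finally have "speed \<gamma> t / (norm (\<gamma> t - (\<gamma> t1 + \<sigma> *\<^sub>R n)))\<^sup>2
          \<le> \<kappa> * (1 - \<eta>)\<^sup>2 * g / ((1 - \<eta>)\<^sup>2 * q \<sigma> t)"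
        using lower[OF t, of \<sigma>] \<eta> qpos[OF \<sigma>] \<kappa> g by (intro frac_le) auto
      thus "speed \<gamma> t / (norm (\<gamma> t - (\<gamma> t1 + \<sigma> *\<^sub>R n)))\<^sup>2 \<le> \<kappa> * g / q \<sigma> t"
        using \<eta> by simp
    qed
    also have "\<dots> = \<kappa> / s * (arctan (g / s * \<delta>) - arctan (g / s * (- \<delta>)))"
      using I by (simp add: integral_unique A_def algebra_simps)
    also have "\<dots> \<le> \<kappa> / s * pi"
      using arctan_ubound[of "g / s * \<delta>"] arctan_lbound[of "g / s * (- \<delta>)"] \<kappa> s
      by (intro mult_left_mono) auto
    finally show ?thesis by (simp add: s_def)
  qed
  from that[OF \<delta>(1,2) ne this] show ?thesis .
qed

lemma compact_curve_separation:
  assumes \<gamma>: "analytic_jordan_curve \<gamma>" and "compact S" "\<And>t. t \<in> S \<Longrightarrow> \<gamma> t \<noteq> p"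
  obtains m where "m > 0" "\<And>t. t \<in> S \<Longrightarrow> m \<le> norm (\<gamma> t - p)"
proof -
  have "closed (\<gamma> ` S)"
    using compact_imp_closed[OF compact_continuous_image[OF analytic_jordan_curve_continuous[OF \<gamma>] \<open>compact S\<close>]] .
  from separate_point_closed[OF this, of p] assms(3) obtain m
    where "m > 0" "\<forall>x\<in>\<gamma> ` S. m \<le> dist p x" by blast
  thus ?thesis by (intro that[of m]) (auto simp: dist_norm norm_minus_commute)
qed

lemma speed_bounded:
  assumes \<gamma>: "analytic_jordan_curve \<gamma>"
  obtains M where "M > 0" "\<And>t. t \<in> {a..b} \<Longrightarrow> speed \<gamma> t \<le> M"
proof -
  have "compact (velocity \<gamma> ` {a..b})"
    using analytic_jordan_curve_continuous_velocity[OF \<gamma>] compact_continuous_image compact_Icc by blast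
  hence "bounded (velocity \<gamma> ` {a..b})" by (rule compact_imp_bounded)
  then obtain M where "M > 0" "\<forall>x\<in>velocity \<gamma> ` {a..b}. norm x \<le> M"
    unfolding bounded_pos by metis
  thus ?thesis by (intro that[of M]) auto
qed

text \<open>If the arc keeps distance \<open>m\<close> from \<open>p\<close>, then moving the pole
  from \<open>p\<close> by less than \<open>m / 2\<close> leaves it at distance at least
  \<open>m / 2\<close>, so the kernel is bounded uniformly in \<open>\<sigma>\<close>.\<close>

lemma far_poisson_mass_bound:
  assumes \<gamma>: "analytic_jordan_curve \<gamma>" and "\<And>t. t \<in> {a..b} \<Longrightarrow> \<gamma> t \<noteq> p" and n: "norm n = 1"
  obtains C \<epsilon> where "\<epsilon> > 0" 
     "\<forall>\<sigma> t. \<bar>\<sigma>\<bar> < \<epsilon> \<longrightarrow> t \<in> {a..b} \<longrightarrow> \<gamma> t \<noteq> p + \<sigma> *\<^sub>R n"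
     "\<forall>\<sigma>. \<bar>\<sigma>\<bar> < \<epsilon> \<longrightarrow> integral {a..b} (\<lambda>t. speed \<gamma> t / (norm (\<gamma> t - (p + \<sigma> *\<^sub>R n)))\<^sup>2) \<le> C"
proof -
  obtain m where m: "m > 0" "\<And>t. t \<in> {a..b} \<Longrightarrow> m \<le> norm (\<gamma> t - p)"
    using compact_curve_separation[OF \<gamma> compact_Icc assms(2)] by metis
  obtain M where M: "M > 0" "\<And>t. t \<in> {a..b} \<Longrightarrow> speed \<gamma> t \<le> M"
    by (rule speed_bounded[OF \<gamma>]) blast
  have far: "m / 2 \<le> norm (\<gamma> t - (p + \<sigma> *\<^sub>R n))" if "\<bar>\<sigma>\<bar> < m / 2" "t \<in> {a..b}" for \<sigma> t
  proof -
    have "norm (\<gamma> t - p) \<le> norm (\<gamma> t - (p + \<sigma> *\<^sub>R n)) + norm (\<sigma> *\<^sub>R n)"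
      using norm_triangle_ineq[of "\<gamma> t - (p + \<sigma> *\<^sub>R n)" "\<sigma> *\<^sub>R n"]
      by (simp add: algebra_simps)
    also have "norm (\<sigma> *\<^sub>R n) = \<bar>\<sigma>\<bar>" using n by simp
    finally show ?thesis using m(2)[OF that(2)] that(1) by linarith
  qed
  have ne: "\<gamma> t \<noteq> p + \<sigma> *\<^sub>R n" if "\<bar>\<sigma>\<bar> < m / 2" "t \<in> {a..b}" for \<sigma> t
    using far[OF that] m by auto
  have "integral {a..b} (\<lambda>t. speed \<gamma> t / (norm (\<gamma> t - (p + \<sigma> *\<^sub>R n)))\<^sup>2)
        \<le> integral {a..b} (\<lambda>t. M / (m / 2)\<^sup>2)" if \<sigma>: "\<bar>\<sigma>\<bar> < m / 2" for \<sigma>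
  proof (rule integral_le)
    show "(\<lambda>t. speed \<gamma> t / (norm (\<gamma> t - (p + \<sigma> *\<^sub>R n)))\<^sup>2) integrable_on {a..b}"
      using ne[OF \<sigma>] by (intro integrable_continuous_interval continuous_intros \<gamma>) auto
    fix t assume t: "t \<in> {a..b}"
    show "speed \<gamma> t / (norm (\<gamma> t - (p + \<sigma> *\<^sub>R n)))\<^sup>2 \<le> M / (m / 2)\<^sup>2"
      using M far[OF \<sigma> t] m t by (intro frac_le power_mono) auto
  qed auto
  with ne m show ?thesis by (intro that[of "m / 2"]) auto
qed

text \<open>One period centred at \<open>t1\<close> is cut into a short middle arc, which carries
  the singular term, and two outer arcs. By injectivity the outer arcs avoid
  \<open>\<gamma> t1\<close>, so they contribute only to the constant \<open>C\<close>.\<close>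

lemma poisson_mass_bound:
  assumes \<gamma>: "analytic_jordan_curve \<gamma>" and n: "norm n = 1" "inner n (velocity \<gamma> t1) = 0"
    and \<kappa>: "\<kappa> > 1" and t1: "1/2 \<le> t1" "t1 \<le> 3/2"
  obtains C where "\<forall>\<^sub>F \<sigma> in at 0. integral {0..1}
     (\<lambda>t. speed \<gamma> t / (norm (\<gamma> t - (\<gamma> t1 + \<sigma> *\<^sub>R n)))\<^sup>2) \<le> \<kappa> * pi / \<bar>\<sigma>\<bar> + C"
proof -
  obtain \<delta> where \<delta>: "0 < \<delta>" "\<delta> < 1/2"
    and ne: "\<And>\<sigma> t. \<sigma> \<noteq> 0 \<Longrightarrow> \<bar>t - t1\<bar> \<le> \<delta> \<Longrightarrow> \<gamma> t \<noteq> \<gamma> t1 + \<sigma> *\<^sub>R n"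
    and I: "\<And>\<sigma>. \<sigma> \<noteq> 0 \<Longrightarrow> integral {t1 - \<delta>..t1 + \<delta>}
        (\<lambda>t. speed \<gamma> t / (norm (\<gamma> t - (\<gamma> t1 + \<sigma> *\<^sub>R n)))\<^sup>2) \<le> \<kappa> * pi / \<bar>\<sigma>\<bar>"
    by (rule local_poisson_mass_bound[OF \<gamma> n \<kappa>]) blast
  have inj: "\<gamma> t \<noteq> \<gamma> t1" if "t \<noteq> t1" "\<bar>t - t1\<bar> < 1" for t
    using analytic_jordan_curve_inj[OF \<gamma>, of t t1] that by auto
  have inj1: "\<gamma> t \<noteq> \<gamma> t1" if "t \<in> {t1 - 1/2..t1 - \<delta>}" for t
    using that \<delta> by (intro inj) (auto simp: abs_less_iff)
  obtain C1 e1 where e1: "e1 > 0"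
     "\<forall>\<sigma> t. \<bar>\<sigma>\<bar> < e1 \<longrightarrow> t \<in> {t1 - 1/2..t1 - \<delta>} \<longrightarrow> \<gamma> t \<noteq> \<gamma> t1 + \<sigma> *\<^sub>R n"
     "\<forall>\<sigma>. \<bar>\<sigma>\<bar> < e1 \<longrightarrow> integral {t1 - 1/2..t1 - \<delta>} (\<lambda>t. speed \<gamma> t / (norm (\<gamma> t - (\<gamma> t1 + \<sigma> *\<^sub>R n)))\<^sup>2) \<le> C1"
    by (rule far_poisson_mass_bound[OF \<gamma> inj1 n(1)])
  have inj2: "\<gamma> t \<noteq> \<gamma> t1" if "t \<in> {t1 + \<delta>..t1 + 1/2}" for t
    using that \<delta> by (intro inj) (auto simp: abs_less_iff)
  obtain C2 e2 where e2: "e2 > 0"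
     "\<forall>\<sigma> t. \<bar>\<sigma>\<bar> < e2 \<longrightarrow> t \<in> {t1 + \<delta>..t1 + 1/2} \<longrightarrow> \<gamma> t \<noteq> \<gamma> t1 + \<sigma> *\<^sub>R n"
     "\<forall>\<sigma>. \<bar>\<sigma>\<bar> < e2 \<longrightarrow> integral {t1 + \<delta>..t1 + 1/2} (\<lambda>t. speed \<gamma> t / (norm (\<gamma> t - (\<gamma> t1 + \<sigma> *\<^sub>R n)))\<^sup>2) \<le> C2"
    by (rule far_poisson_mass_bound[OF \<gamma> inj2 n(1)])
  have "integral {0..1} (\<lambda>t. speed \<gamma> t / (norm (\<gamma> t - (\<gamma> t1 + \<sigma> *\<^sub>R n)))\<^sup>2)
          \<le> \<kappa> * pi / \<bar>\<sigma>\<bar> + (C1 + C2)" if \<sigma>: "\<sigma> \<noteq> 0" "\<bar>\<sigma>\<bar> < min e1 e2" for \<sigma>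
  proof -
    define f where "f = (\<lambda>t. speed \<gamma> t / (norm (\<gamma> t - (\<gamma> t1 + \<sigma> *\<^sub>R n)))\<^sup>2)"
    have per: "f (t + 1) = f t" for t
      by (simp add: f_def analytic_jordan_curve_period[OF \<gamma>] analytic_jordan_curve_velocity_period[OF \<gamma>])
    have ne1: "\<gamma> t \<noteq> \<gamma> t1 + \<sigma> *\<^sub>R n" if "t \<in> {t1 - 1/2..t1 + 1/2}" for t
    proof -
      have "t \<in> {t1 - 1/2..t1 - \<delta>} \<or> \<bar>t - t1\<bar> \<le> \<delta> \<or> t \<in> {t1 + \<delta>..t1 + 1/2}"
        using that unfolding atLeastAtMost_iff abs_le_iff by linarith
      thus ?thesis using e1(2) e2(2) ne \<sigma> by (elim disjE) auto
    qed
    have "\<gamma> t \<noteq> \<gamma> t1 + \<sigma> *\<^sub>R n" for t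
    proof -
      obtain s where s: "\<bar>s - t1\<bar> \<le> 1/2" "\<gamma> s = \<gamma> t"
        using analytic_jordan_curve_centered[OF \<gamma>] by blast
      hence "s \<in> {t1 - 1/2..t1 + 1/2}" unfolding abs_le_iff atLeastAtMost_iff by linarith
      thus ?thesis using ne1[of s] s by simp
    qed
    hence cont: "continuous_on UNIV f"
      unfolding f_def by (intro continuous_intros \<gamma>) auto
    have int: "f integrable_on {u..v}" for u v
      using cont continuous_on_subset by (blast intro: integrable_continuous_interval)
    have "integral {0..1} f = integral {t1 - 1/2..t1 + 1/2} f"
      using integral_unit_periodic[OF cont per, of "t1 - 1/2"] t1 by (simp add: add.commute)
    also have "\<dots> = integral {t1 - 1/2..t1 - \<delta>} f + integral {t1 - \<delta>..t1 + 1/2} f"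
      using \<delta> by (intro Henstock_Kurzweil_Integration.integral_combine[symmetric] int) auto
    also have "integral {t1 - \<delta>..t1 + 1/2} f = integral {t1 - \<delta>..t1 + \<delta>} f + integral {t1 + \<delta>..t1 + 1/2} f"
      using \<delta> by (intro Henstock_Kurzweil_Integration.integral_combine[symmetric] int) auto
    finally show ?thesis
      using I[OF \<sigma>(1)] e1(3)[rule_format, of \<sigma>] e2(3)[rule_format, of \<sigma>] \<sigma>(2) unfolding f_def by linarith
  qed
  hence "\<forall>\<^sub>F \<sigma> in at 0. integral {0..1}
     (\<lambda>t. speed \<gamma> t / (norm (\<gamma> t - (\<gamma> t1 + \<sigma> *\<^sub>R n)))\<^sup>2) \<le> \<kappa> * pi / \<bar>\<sigma>\<bar> + (C1 + C2)"
    using e1(1) e2(1) unfolding eventually_at by (intro exI[of _ "min e1 e2"]) auto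
  thus ?thesis by (rule that)
qed

subsection \<open>Points off the closure along a normal\<close>

text \<open>The squared distance to \<open>z0\<close> has a minimum at \<open>t1\<close>, so its
  derivative vanishes there. On a circle about \<open>z0\<close> every parameter qualifies, and this
  is used again for the disc.\<close>

lemma nearest_point_normal:
  assumes \<gamma>: "analytic_jordan_curve \<gamma>" and min: "\<And>t. norm (\<gamma> t1 - z0) \<le> norm (\<gamma> t - z0)"
  shows "inner (\<gamma> t1 - z0) (velocity \<gamma> t1) = 0"
proof -
  have "((\<lambda>t. inner (\<gamma> t - z0) (\<gamma> t - z0)) has_derivative
      (\<lambda>h. inner (\<gamma> t1 - z0) (h *\<^sub>R velocity \<gamma> t1) + inner (h *\<^sub>R velocity \<gamma> t1) (\<gamma> t1 - z0))) (at t1)"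
    using analytic_jordan_curve_has_velocity[OF \<gamma>, of t1] unfolding has_vector_derivative_def
    by (auto intro!: derivative_eq_intros)
  hence "((\<lambda>t. inner (\<gamma> t - z0) (\<gamma> t - z0)) has_real_derivative
      2 * inner (\<gamma> t1 - z0) (velocity \<gamma> t1)) (at t1)"
    unfolding has_field_derivative_def
    by (rule has_derivative_eq_rhs) (auto simp: inner_commute)
  moreover have "inner (\<gamma> t1 - z0) (\<gamma> t1 - z0) \<le> inner (\<gamma> t - z0) (\<gamma> t - z0)" for t
    using min[of t] by (simp add: dot_square_norm power_mono)
  ultimately have "2 * inner (\<gamma> t1 - z0) (velocity \<gamma> t1) = 0"
    by (intro DERIV_local_min[of _ _ t1 1]) auto
  thus ?thesis by simp
qed

text \<open>In the plane the vectors orthogonal to \<open>u\<close> form a line. Multiplication by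
  \<open>cnj u\<close> makes both \<open>n\<close> and \<open>v\<close> purely imaginary, so the
  scalar is a quotient of imaginary parts.\<close>

lemma complex_orthogonal_collinear:
  fixes n u v :: complex
  assumes "norm n = 1" "u \<noteq> 0" "inner n u = 0" "inner v u = 0"
  shows "\<exists>\<sigma>. v = \<sigma> *\<^sub>R n"
proof -
  have Re0: "Re (n * cnj u) = 0" "Re (v * cnj u) = 0"
    using assms by (simp_all add: inner_complex_def)
  have "n * cnj u \<noteq> 0" using assms by auto
  hence "Im (n * cnj u) \<noteq> 0" using Re0 by (simp add: complex_eq_iff)
  hence "v * cnj u = (Im (v * cnj u) / Im (n * cnj u)) *\<^sub>R n * cnj u"
    using Re0 by (simp add: complex_eq_iff)
  hence "v = (Im (v * cnj u) / Im (n * cnj u)) *\<^sub>R n"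
    using assms(2) by (metis complex_cnj_zero_iff mult_right_cancel)
  thus ?thesis by blast
qed

text \<open>The domain is connected and misses the curve, hence lies in one of the two Jordan
  components; \<open>D\<close> is the other one. It supplies points outside the domain arbitrarily
  close to each point of the curve.\<close>

lemma boundary_curve_complementary_side:
  assumes dom: "bounded_domain \<Omega>" and \<gamma>: "analytic_jordan_curve \<gamma>" and sub: "\<gamma> ` {0..1} \<subseteq> frontier \<Omega>"
  obtains D where "open D" "D \<inter> \<Omega> = {}" "D \<inter> \<gamma> ` {0..1} = {}" "frontier D = \<gamma> ` {0..1}"
proof -
  define P where "P = path_image \<gamma>"
  have P: "P = \<gamma> ` {0..1}" by (simp add: P_def path_image_def)
  note J = Jordan_inside_outside[OF analytic_jordan_curve_paths(2,3)[OF \<gamma>], folded P_def]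
  have op: "open \<Omega>" "connected \<Omega>" using dom by (auto simp: bounded_domain_def)
  hence "\<Omega> \<inter> P = {}" using sub P by (auto simp: frontier_def interior_open)
  hence "\<Omega> \<subseteq> inside P \<union> outside P" using J by auto
  moreover have "inside P \<inter> outside P = {}" using J by blast
  ultimately have "inside P \<inter> \<Omega> = {} \<or> outside P \<inter> \<Omega> = {}"
    using connectedD[OF op(2), of "inside P" "outside P"] J by blast
  thus ?thesis
  proof
    assume "inside P \<inter> \<Omega> = {}"
    thus ?thesis using that[of "inside P"] J P inside_no_overlap[of P] by blast
  next
    assume "outside P \<inter> \<Omega> = {}"
    thus ?thesis using that[of "outside P"] J P outside_no_overlap[of P] by blast
  qed
qed

lemma analytic_boundary_paramD:
  assumes "analytic_boundary_param \<Omega> \<gamma>s" "i < length \<gamma>s"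
  shows "analytic_jordan_curve (\<gamma>s ! i)" "(\<gamma>s ! i) t \<in> frontier \<Omega>"
    "j < length \<gamma>s \<Longrightarrow> i \<noteq> j \<Longrightarrow> (\<gamma>s ! i) s \<noteq> (\<gamma>s ! j) t"
proof -
  have mem: "\<gamma>s ! k \<in> set \<gamma>s" if "k < length \<gamma>s" for k using that by simp
  have ajc: "analytic_jordan_curve (\<gamma>s ! k)" if "k < length \<gamma>s" for k
    using assms(1) mem[OF that] unfolding analytic_boundary_param_def by blast
  show "analytic_jordan_curve (\<gamma>s ! i)" using ajc assms(2) .
  show "(\<gamma>s ! i) t \<in> frontier \<Omega>"
    using assms mem[OF assms(2)] analytic_jordan_curve_mem[OF ajc[OF assms(2)], of t]
    unfolding analytic_boundary_param_def by blast
  show "(\<gamma>s ! i) s \<noteq> (\<gamma>s ! j) t" if j: "j < length \<gamma>s" "i \<noteq> j"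
    using assms j analytic_jordan_curve_mem[OF ajc[OF assms(2)], of s]
      analytic_jordan_curve_mem[OF ajc[OF j(1)], of t]
    unfolding analytic_boundary_param_def by fastforce
qed

text \<open>The other boundary curves, together with the part of this one whose parameter differs
  from \<open>t1\<close> by between \<open>\<delta>\<close> and 1/2, form a compact set
  \<open>K\<close> that misses the point at \<open>t1\<close>. The radius \<open>\<rho>\<close> is a
  lower bound for the distance to \<open>K\<close>.\<close>

lemma frontier_locally_one_arc:
  assumes param: "analytic_boundary_param \<Omega> \<gamma>s" and i: "i < length \<gamma>s" and "\<delta> > 0" "\<delta> \<le> 1/2"
  obtains \<rho> where "\<rho> > 0"
    "\<forall>w\<in>frontier \<Omega>. norm (w - (\<gamma>s ! i) t1) < \<rho> \<longrightarrow> (\<exists>t. \<bar>t - t1\<bar> \<le> \<delta> \<and> w = (\<gamma>s ! i) t)"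
proof -
  define \<gamma> where "\<gamma> = \<gamma>s ! i"
  have \<gamma>: "analytic_jordan_curve \<gamma>" using analytic_boundary_paramD(1)[OF param i] by (simp add: \<gamma>_def)
  define K where "K = (\<Union>j\<in>{..<length \<gamma>s} - {i}. (\<gamma>s ! j) ` {0..1}) \<union> \<gamma> ` ({t1 - 1/2..t1 - \<delta>} \<union> {t1 + \<delta>..t1 + 1/2})"
  have "compact (\<gamma> ` ({t1 - 1/2..t1 - \<delta>} \<union> {t1 + \<delta>..t1 + 1/2}))"
    by (intro compact_continuous_image analytic_jordan_curve_continuous[OF \<gamma>]) auto
  moreover have "compact ((\<gamma>s ! j) ` {0..1})" if "j \<in> {..<length \<gamma>s} - {i}" for j
    using that analytic_boundary_paramD(1)[OF param, of j]
    by (intro compact_continuous_image analytic_jordan_curve_continuous) auto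
  ultimately have "compact K"
    unfolding K_def by (intro compact_Un compact_UN) auto
  hence "closed K" by (rule compact_imp_closed)
  moreover have "\<gamma> t1 \<notin> K"
  proof
    assume "\<gamma> t1 \<in> K"
    then consider j t where "j < length \<gamma>s" "j \<noteq> i" "\<gamma> t1 = (\<gamma>s ! j) t"
      | t where "t \<in> {t1 - 1/2..t1 - \<delta>} \<union> {t1 + \<delta>..t1 + 1/2}" "\<gamma> t1 = \<gamma> t"
      unfolding K_def by blast
    thus False
    proof cases
      case 1
      thus False using analytic_boundary_paramD(3)[OF param i, of j] by (simp add: \<gamma>_def)
    next
      case 2
      hence "\<bar>t1 - t\<bar> < 1" using assms(3,4) by auto
      hence "t1 = t" using analytic_jordan_curve_inj[OF \<gamma>] 2 by blast
      thus False using 2 assms(3) by auto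
    qed
  qed
  ultimately obtain \<rho> where \<rho>: "\<rho> > 0" "\<forall>w\<in>K. \<rho> \<le> dist (\<gamma> t1) w"
    using separate_point_closed by blast
  have "\<exists>t. \<bar>t - t1\<bar> \<le> \<delta> \<and> w = \<gamma> t" if w: "w \<in> frontier \<Omega>" "norm (w - \<gamma> t1) < \<rho>" for w
  proof -
    have notK: "w \<notin> K" using \<rho> w(2) by (auto simp: dist_norm norm_minus_commute)
    obtain \<beta> t where "\<beta> \<in> set \<gamma>s" "t \<in> {0..1}" "w = \<beta> t"
      using w(1) param unfolding analytic_boundary_param_def by auto
    then obtain j where j: "j < length \<gamma>s" "w = (\<gamma>s ! j) t" "t \<in> {0..1}"
      by (metis in_set_conv_nth)
    have "j = i"
    proof (rule ccontr)
      assume "j \<noteq> i"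
      hence "w \<in> K" unfolding K_def using j by blast
      thus False using notK by simp
    qed
    then obtain s where s: "\<bar>s - t1\<bar> \<le> 1/2" "\<gamma> s = w"
      using analytic_jordan_curve_centered[OF \<gamma>, of t1 t] j by (auto simp: \<gamma>_def)
    hence "s \<notin> {t1 - 1/2..t1 - \<delta>} \<union> {t1 + \<delta>..t1 + 1/2}"
      using notK unfolding K_def by blast
    hence "\<bar>s - t1\<bar> \<le> \<delta>"
      using s(1) unfolding abs_le_iff Un_iff atLeastAtMost_iff by linarith
    thus ?thesis using s by blast
  qed
  thus ?thesis using \<rho>(1) by (intro that[of \<rho>]) (auto simp: \<gamma>_def)
qed

text \<open>Translating a short boundary arc along the normal keeps it off the boundary, so it connects
  any nearby point on the far side of the curve to the normal line through \<open>\<gamma> t1\<close>.\<close>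
lemma normal_leaves_closure:
  assumes dom: "bounded_domain \<Omega>" and param: "analytic_boundary_param \<Omega> \<gamma>s"
    and i: "i < length \<gamma>s" and n: "norm n = 1" "inner n (velocity (\<gamma>s ! i) t1) = 0"
  shows "\<exists>\<^sub>F \<sigma> in at 0. (\<gamma>s ! i) t1 + \<sigma> *\<^sub>R n \<notin> closure \<Omega>"
proof -
  define \<gamma> where "\<gamma> = \<gamma>s ! i"
  have \<gamma>: "analytic_jordan_curve \<gamma>" using analytic_boundary_paramD(1)[OF param i] by (simp add: \<gamma>_def)
  define u where "u = velocity \<gamma> t1"
  have u: "u \<noteq> 0" using analytic_jordan_curve_speed_pos[OF \<gamma>, of t1] by (simp add: u_def)
  have nu: "inner n u = 0" using n by (simp add: u_def \<gamma>_def)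
  define p where "p = \<gamma> t1"
  \<comment> \<open>The tangential coordinate along the curve. It is strictly increasing near
    \<open>t1\<close> and unchanged by translation along \<open>n\<close>, so a translate of a short
    arc can meet the arc only at equal parameters, which means not at all unless the shift is
    zero.\<close>
  define x where "x = (\<lambda>t. inner (\<gamma> t - p) u)"
  have dx: "(x has_real_derivative inner (velocity \<gamma> t) u) (at t)" for t
  proof -
    have "(x has_derivative (\<lambda>h. inner (h *\<^sub>R velocity \<gamma> t) u)) (at t)"
      using analytic_jordan_curve_has_velocity[OF \<gamma>, of t] unfolding has_vector_derivative_def x_def
      by (auto intro!: derivative_eq_intros)
    thus ?thesis
      unfolding has_field_derivative_def by (rule has_derivative_eq_rhs) auto
  qed
  have contx: "continuous_on A x" for A unfolding x_def by (intro continuous_intros \<gamma>)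
  have "continuous_on UNIV (\<lambda>t. inner (velocity \<gamma> t) u)" by (intro continuous_intros \<gamma>)
  hence "isCont (\<lambda>t. inner (velocity \<gamma> t) u) t1" by (simp add: continuous_on_eq_continuous_at)
  moreover have "inner (velocity \<gamma> t1) u > 0" using u by (simp add: u_def)
  ultimately obtain d0 where d0: "d0 > 0"
    "\<And>t. \<bar>t - t1\<bar> < d0 \<Longrightarrow> \<bar>inner (velocity \<gamma> t) u - inner (velocity \<gamma> t1) u\<bar> < inner (velocity \<gamma> t1) u"
    unfolding continuous_at_eps_delta dist_real_def by blast
  define \<delta> where "\<delta> = min d0 1 / 2"
  have \<delta>: "\<delta> > 0" "\<delta> \<le> 1/2" "\<delta> < d0" using d0(1) by (auto simp: \<delta>_def)
  have mono: "x s < x t" if "t1 - \<delta> \<le> s" "s < t" "t \<le> t1 + \<delta>" for s t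
  proof (rule DERIV_pos_imp_increasing[OF that(2)])
    fix y assume y: "s \<le> y" "y \<le> t"
    hence "\<bar>y - t1\<bar> < d0" using that \<delta> unfolding abs_less_iff by linarith
    hence "inner (velocity \<gamma> y) u > 0" using d0(2)[of y] unfolding abs_less_iff by linarith
    thus "\<exists>l. (x has_real_derivative l) (at y) \<and> 0 < l" using dx by blast
  qed
  have x_inj: "s = t" if "\<bar>s - t1\<bar> \<le> \<delta>" "\<bar>t - t1\<bar> \<le> \<delta>" "x s = x t" for s t
    using mono[of s t] mono[of t s] that unfolding abs_le_iff by linarith
  have x0: "x t1 = 0" by (simp add: x_def p_def)
  obtain \<rho> where \<rho>: "\<rho> > 0"
    "\<forall>w\<in>frontier \<Omega>. norm (w - p) < \<rho> \<longrightarrow> (\<exists>t. \<bar>t - t1\<bar> \<le> \<delta> \<and> w = \<gamma> t)"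
    unfolding p_def \<gamma>_def by (rule frontier_locally_one_arc[OF param i \<delta>(1,2)])
  have sub: "\<gamma> ` {0..1} \<subseteq> frontier \<Omega>"
    using analytic_boundary_paramD(2)[OF param i] by (auto simp: \<gamma>_def)
  obtain D where D: "open D" "D \<inter> \<Omega> = {}" "D \<inter> \<gamma> ` {0..1} = {}" "frontier D = \<gamma> ` {0..1}"
    by (rule boundary_curve_complementary_side[OF dom \<gamma> sub])
  have "p \<in> closure D"
    using analytic_jordan_curve_mem[OF \<gamma>, of t1] D(4) by (auto simp: p_def frontier_def)
  have "\<exists>\<sigma>. \<sigma> \<noteq> 0 \<and> \<bar>\<sigma>\<bar> < d \<and> p + \<sigma> *\<^sub>R n \<notin> closure \<Omega>" if d: "d > 0" for d
  proof -
    define e where "e = min \<rho> d"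
    have e: "e > 0" using \<rho>(1) d by (simp add: e_def)
    have "isCont \<gamma> t1"
      using analytic_jordan_curve_continuous[OF \<gamma>, of UNIV] by (simp add: continuous_on_eq_continuous_at)
    moreover have "e / 4 > 0" using e by simp
    ultimately obtain d1 where d1: "d1 > 0" "\<And>t. \<bar>t - t1\<bar> < d1 \<Longrightarrow> norm (\<gamma> t - p) < e / 4"
      unfolding continuous_at_eps_delta dist_real_def dist_norm p_def by blast
    define h where "h = min \<delta> (d1 / 2)"
    have h: "h > 0" "h \<le> \<delta>" "h < d1" using \<delta> d1(1) by (auto simp: h_def)
    have xl: "x (t1 - h) < 0" and xr: "x (t1 + h) > 0"
      using mono[of "t1 - h" t1] mono[of t1 "t1 + h"] h \<delta> x0 by auto
    define m where "m = min (x (t1 + h)) (- x (t1 - h))"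
    have m: "m > 0" using xl xr by (simp add: m_def)
    \<comment> \<open>The first bound keeps the shift \<open>\<sigma>\<close> below
      \<open>e / 2\<close>; the second keeps the tangential coordinate of \<open>a\<close> within
      the range of \<open>x\<close> on \<open>{t1 - h..t1 + h}\<close>.\<close>
    define \<epsilon> where "\<epsilon> = min (e / 4) (m / norm u)"
    have "\<epsilon> > 0" using e m u by (simp add: \<epsilon>_def)
    then obtain a where a: "a \<in> D" "norm (a - p) < \<epsilon>"
      using \<open>p \<in> closure D\<close> unfolding closure_approachable dist_norm by blast
    have "\<bar>inner (a - p) u\<bar> \<le> norm (a - p) * norm u" by (rule Cauchy_Schwarz_ineq2)
    also have "\<dots> \<le> m / norm u * norm u"
      using a(2) by (intro mult_right_mono) (auto simp: \<epsilon>_def)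
    finally have "\<bar>inner (a - p) u\<bar> \<le> m" using u by simp
    hence "x (t1 - h) \<le> inner (a - p) u" "inner (a - p) u \<le> x (t1 + h)"
      unfolding m_def by linarith+
    \<comment> \<open>The foot of \<open>a\<close> on the curve along the direction
      \<open>n\<close>: equal tangential coordinates make \<open>a - \<gamma> t\<close> a multiple
      of \<open>n\<close>.\<close>
    then obtain t where t: "t1 - h \<le> t" "t \<le> t1 + h" "x t = inner (a - p) u"
      using IVT'[of x "t1 - h" "inner (a - p) u" "t1 + h"] contx h by auto
    have "inner (a - \<gamma> t) u = 0" using t(3) by (simp add: x_def inner_diff_left)
    from complex_orthogonal_collinear[OF n(1) u nu this] obtain \<sigma> where \<sigma>: "a - \<gamma> t = \<sigma> *\<^sub>R n" ..
    have aeq: "a = \<gamma> t + \<sigma> *\<^sub>R n" using \<sigma> by (simp add: algebra_simps)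
    have "a \<noteq> \<gamma> t" using a(1) D(3) analytic_jordan_curve_mem[OF \<gamma>, of t] by blast
    hence \<sigma>0: "\<sigma> \<noteq> 0" using aeq by auto
    have near: "norm (\<gamma> s - p) < e / 4" if "\<bar>s - t1\<bar> \<le> h" for s
      using d1(2)[of s] that h by linarith
    have th: "\<bar>t - t1\<bar> \<le> h" using t unfolding abs_le_iff by linarith
    have "\<bar>\<sigma>\<bar> = norm (a - \<gamma> t)" using \<sigma> n(1) by simp
    also have "\<dots> \<le> norm (a - p) + norm (\<gamma> t - p)"
      using norm_triangle_ineq4[of "a - p" "\<gamma> t - p"] by simp
    also have "\<dots> < e / 2" using a(2) near[OF th] unfolding \<epsilon>_def by linarith
    finally have \<sigma>e: "\<bar>\<sigma>\<bar> < e / 2" .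
    \<comment> \<open>The arc between \<open>\<gamma> t1\<close> and \<open>\<gamma> t\<close>,
      shifted by \<open>\<sigma> *\<^sub>R n\<close>: a connected set joining
      \<open>p + \<sigma> *\<^sub>R n\<close> to \<open>a\<close>.\<close>
    define K where "K = (\<lambda>s. \<gamma> s + \<sigma> *\<^sub>R n) ` closed_segment t1 t"
    have "connected K"
      unfolding K_def by (intro connected_continuous_image continuous_intros \<gamma>) auto
    have seg: "\<bar>s - t1\<bar> \<le> h" if "s \<in> closed_segment t1 t" for s
      using that th unfolding closed_segment_eq_real_ivl abs_le_iff
      by (auto split: if_splits)
    have disj: "w \<notin> frontier \<Omega>" if wK: "w \<in> K" for w
    proof
      assume w: "w \<in> frontier \<Omega>"
      obtain s where s: "s \<in> closed_segment t1 t" "w = \<gamma> s + \<sigma> *\<^sub>R n"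
        using wK by (auto simp: K_def)
      have "norm (w - p) \<le> norm (\<gamma> s - p) + norm (\<sigma> *\<^sub>R n)"
        using norm_triangle_ineq[of "\<gamma> s - p" "\<sigma> *\<^sub>R n"] s(2) by (simp add: algebra_simps)
      also have "norm (\<sigma> *\<^sub>R n) = \<bar>\<sigma>\<bar>" using n(1) by simp
      finally have "norm (w - p) < \<rho>" using \<sigma>e near[OF seg[OF s(1)]] e unfolding e_def by linarith
      then obtain s' where s': "\<bar>s' - t1\<bar> \<le> \<delta>" "w = \<gamma> s'" using \<rho>(2) w by blast
      have "\<gamma> s' = \<gamma> s + \<sigma> *\<^sub>R n" using s s' by simp
      hence "x s' = x s" by (simp add: x_def inner_diff_left inner_add_left nu)
      hence "s' = s" using x_inj[of s' s] s'(1) seg[OF s(1)] h(2) by simp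
      hence "\<sigma> *\<^sub>R n = 0" using s s' by simp
      thus False using \<sigma>0 n(1) by auto
    qed
    have "a \<in> K" "p + \<sigma> *\<^sub>R n \<in> K" unfolding K_def aeq p_def by auto
    moreover have "a \<notin> \<Omega>" using a(1) D(2) by blast
    \<comment> \<open>A connected set that misses the frontier lies entirely inside or entirely
      outside the domain, and \<open>a\<close> decides for the outside.\<close>
    ultimately have "K \<inter> \<Omega> = {}"
      using connected_Int_frontier[OF \<open>connected K\<close>, of \<Omega>] disj by blast
    hence "p + \<sigma> *\<^sub>R n \<notin> closure \<Omega>"
      using \<open>p + \<sigma> *\<^sub>R n \<in> K\<close> disj closure_Un_frontier[of \<Omega>] by blast
    moreover have "\<bar>\<sigma>\<bar> < d" using \<sigma>e e unfolding e_def by linarith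
    ultimately show ?thesis using \<sigma>0 by blast
  qed
  thus ?thesis unfolding frequently_at by (auto simp: p_def \<gamma>_def)
qed

subsection \<open>Boundary length\<close>

text \<open>The singular term comes only from the curve through the limiting point. Each other curve
  has positive distance from that point by disjointness and adds a constant.\<close>

lemma total_poisson_mass_bound:
  assumes param: "analytic_boundary_param \<Omega> \<gamma>s" and i: "i < length \<gamma>s"
    and n: "norm n = 1" "inner n (velocity (\<gamma>s ! i) t1) = 0"
    and \<kappa>: "\<kappa> > 1" and t1: "1/2 \<le> t1" "t1 \<le> 3/2"
  obtains C where "\<forall>\<^sub>F \<sigma> in at 0. (\<Sum>\<gamma>\<leftarrow>\<gamma>s. integral {0..1}
     (\<lambda>t. speed \<gamma> t / (norm (\<gamma> t - ((\<gamma>s ! i) t1 + \<sigma> *\<^sub>R n)))\<^sup>2)) \<le> \<kappa> * pi / \<bar>\<sigma>\<bar> + C"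
proof -
  define N where "N = length \<gamma>s"
  define M where "M = (\<lambda>j \<sigma>. integral {0..1}
     (\<lambda>t. speed (\<gamma>s ! j) t / (norm ((\<gamma>s ! j) t - ((\<gamma>s ! i) t1 + \<sigma> *\<^sub>R n)))\<^sup>2))"
  have "\<exists>C. \<forall>\<^sub>F \<sigma> in at 0. M j \<sigma> \<le> (if j = i then \<kappa> * pi / \<bar>\<sigma>\<bar> else 0) + C" if j: "j < N" for j
  proof (cases "j = i")
    case True
    obtain C where "\<forall>\<^sub>F \<sigma> in at 0. M i \<sigma> \<le> \<kappa> * pi / \<bar>\<sigma>\<bar> + C"
      unfolding M_def by (rule poisson_mass_bound[OF analytic_boundary_paramD(1)[OF param i] n \<kappa> t1])
    thus ?thesis using True by auto
  next
    case False
    note ajc = analytic_boundary_paramD(1)[OF param j[unfolded N_def]]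
    have ne: "(\<gamma>s ! j) t \<noteq> (\<gamma>s ! i) t1" for t
      using analytic_boundary_paramD(3)[OF param j[unfolded N_def] i False] .
    obtain C \<epsilon> where "\<epsilon> > 0" "\<forall>\<sigma>. \<bar>\<sigma>\<bar> < \<epsilon> \<longrightarrow> M j \<sigma> \<le> C"
      unfolding M_def by (rule far_poisson_mass_bound[OF ajc ne n(1)])
    hence "\<forall>\<^sub>F \<sigma> in at 0. M j \<sigma> \<le> C"
      unfolding eventually_at by (intro exI[of _ \<epsilon>]) auto
    thus ?thesis using False by auto
  qed
  then obtain C where C: "\<And>j. j < N \<Longrightarrow> \<forall>\<^sub>F \<sigma> in at 0. M j \<sigma> \<le> (if j = i then \<kappa> * pi / \<bar>\<sigma>\<bar> else 0) + C j"
    by metis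
  have "\<forall>\<^sub>F \<sigma> in at 0. \<forall>j\<in>{..<N}. M j \<sigma> \<le> (if j = i then \<kappa> * pi / \<bar>\<sigma>\<bar> else 0) + C j"
    using C by (intro eventually_ball_finite) auto
  hence "\<forall>\<^sub>F \<sigma> in at 0. (\<Sum>j<N. M j \<sigma>) \<le> \<kappa> * pi / \<bar>\<sigma>\<bar> + (\<Sum>j<N. C j)"
  proof eventually_elim
    case (elim \<sigma>)
    hence "(\<Sum>j<N. M j \<sigma>) \<le> (\<Sum>j<N. (if j = i then \<kappa> * pi / \<bar>\<sigma>\<bar> else 0) + C j)"
      by (intro sum_mono) auto
    thus ?case using i by (simp add: sum.distrib N_def)
  qed
  moreover have "(\<Sum>j<N. M j \<sigma>) = (\<Sum>\<gamma>\<leftarrow>\<gamma>s. integral {0..1}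
     (\<lambda>t. speed \<gamma> t / (norm (\<gamma> t - ((\<gamma>s ! i) t1 + \<sigma> *\<^sub>R n)))\<^sup>2))" for \<sigma>
    by (simp add: sum_list_sum_nth N_def M_def atLeast0LessThan)
  ultimately show ?thesis using that by simp
qed

lemma analytic_boundary_param_setD:
  assumes "analytic_boundary_param \<Omega> \<gamma>s" "\<gamma> \<in> set \<gamma>s"
  shows "analytic_jordan_curve \<gamma>" "\<gamma> t \<in> frontier \<Omega>"
proof -
  obtain i where "i < length \<gamma>s" "\<gamma> = \<gamma>s ! i" using assms(2) by (metis in_set_conv_nth)
  thus "analytic_jordan_curve \<gamma>" "\<gamma> t \<in> frontier \<Omega>"
    using analytic_boundary_paramD(1,2)[OF assms(1)] by auto
qed

lemma continuous_closure_compose_boundary: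
  assumes "analytic_boundary_param \<Omega> \<gamma>s" "\<gamma> \<in> set \<gamma>s" "continuous_on (closure \<Omega>) F"
  shows "continuous_on A (\<lambda>t. F (\<gamma> t))"
proof (rule continuous_on_compose2[OF assms(3)])
  show "continuous_on A \<gamma>"
    using analytic_jordan_curve_continuous analytic_boundary_param_setD(1)[OF assms(1,2)] .
  show "\<gamma> ` A \<subseteq> closure \<Omega>"
    using analytic_boundary_param_setD(2)[OF assms(1,2)] by (auto simp: frontier_def)
qed

section \<open>Testing the projection against Cauchy kernels\<close>

text \<open>Continuity on the compact parameter interval gives square integrability, and
  \<open>F\<close> serves as its own approximant for every \<open>e\<close>.\<close>

lemma hardy_space_holomorphic:
  assumes param: "analytic_boundary_param \<Omega> \<gamma>s"
    and F: "F holomorphic_on \<Omega>" "continuous_on (closure \<Omega>) F"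
  shows "F \<in> hardy_space \<Omega> \<gamma>s"
proof -
  have "bdry_L2 \<gamma>s F"
    unfolding bdry_L2_def
  proof (intro ballI conjI)
    fix \<gamma> assume \<gamma>: "\<gamma> \<in> set \<gamma>s"
    note cont = continuous_closure_compose_boundary[OF param \<gamma> F(2), of "{0..1}"]
    note ajc = analytic_boundary_param_setD(1)[OF param \<gamma>]
    show "set_borel_measurable lborel {0..1} (\<lambda>t. F (\<gamma> t))"
      using borel_measurable_continuous_on_indicator[OF _ cont] by (simp add: set_borel_measurable_def)
    show "set_integrable lborel {0..1} (\<lambda>t. (norm (F (\<gamma> t)))\<^sup>2 * speed \<gamma> t)"
      by (intro borel_integrable_atLeastAtMost' continuous_intros cont ajc)
  qed
  moreover have "bdry_norm_sq \<gamma>s (\<lambda>z. F z - F z) = 0"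
    by (simp add: bdry_norm_sq_def)
  ultimately show ?thesis
    unfolding hardy_space_def using F by (auto intro!: exI[of _ F])
qed

text \<open>Expanding \<open>2 * Re (w * cnj (w - b))\<close> produces a Poisson-type kernel with
  pole \<open>b\<close>. This turns the complex orthogonality relation into a real one that can be
  estimated.\<close>

lemma two_Re_divide_diff:
  fixes w b :: complex
  assumes "w \<noteq> b"
  shows "2 * Re (w / (w - b)) = 1 - ((norm b)\<^sup>2 - (norm w)\<^sup>2) / (norm (w - b))\<^sup>2"
proof -
  have "Re (w / (w - b)) = Re (w * cnj (w - b)) / (norm (w - b))\<^sup>2"
    by (subst complex_div_cnj) (simp flip: of_real_power)
  moreover have "2 * Re (w * cnj (w - b)) = (norm (w - b))\<^sup>2 - ((norm b)\<^sup>2 - (norm w)\<^sup>2)"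
    by (simp add: cmod_power2) (simp add: power2_eq_square algebra_simps)
  moreover have "(norm (w - b))\<^sup>2 \<noteq> 0" using assms by simp
  ultimately show ?thesis by (simp add: field_simps)
qed

lemma length_le_poisson_mass:
  assumes param: "analytic_boundary_param \<Omega> \<gamma>s"
    and proj: "is_szego_projection \<Omega> \<gamma>s cnj (\<lambda>_. c)" and a: "a \<notin> closure \<Omega>"
    and r: "0 \<le> r" "\<And>w. w \<in> frontier \<Omega> \<Longrightarrow> r \<le> norm (w - cnj c)"
  shows "(\<Sum>\<gamma>\<leftarrow>\<gamma>s. curve_length \<gamma>) \<le>
    ((norm (a - cnj c))\<^sup>2 - r\<^sup>2) * (\<Sum>\<gamma>\<leftarrow>\<gamma>s. integral {0..1} (\<lambda>t. speed \<gamma> t / (norm (\<gamma> t - a))\<^sup>2))"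
proof -
  define h where "h = (\<lambda>z. 1 / (z - a))"
  have "h \<in> hardy_space \<Omega> \<gamma>s"
    using a closure_subset[of \<Omega>] unfolding h_def
    by (intro hardy_space_holomorphic[OF param] holomorphic_intros continuous_intros) auto
  hence zero: "bdry_inner \<gamma>s (\<lambda>z. cnj z - c) h = 0"
    using proj by (simp add: is_szego_projection_def)
  define q where "q = (norm (a - cnj c))\<^sup>2 - r\<^sup>2"
  define f where "f = (\<lambda>\<gamma> t. (cnj (\<gamma> t) - c) * cnj (h (\<gamma> t)) * complex_of_real (speed \<gamma> t))"
  define P where "P = (\<lambda>\<gamma>. integral {0..1} (\<lambda>t. speed \<gamma> t / (norm (\<gamma> t - a))\<^sup>2))"
  have ineq: "curve_length \<gamma> - q * P \<gamma> \<le> 2 * Re (set_lebesgue_integral lborel {0..1} (f \<gamma>))"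
    if \<gamma>: "\<gamma> \<in> set \<gamma>s" for \<gamma>
  proof -
    note ajc = analytic_boundary_param_setD(1)[OF param \<gamma>]
    have fr: "\<gamma> t \<in> frontier \<Omega>" for t using analytic_boundary_param_setD(2)[OF param \<gamma>] .
    hence ne: "\<gamma> t \<noteq> a" for t using a by (metis DiffD1 frontier_def)
    have cont: "continuous_on {0..1} (f \<gamma>)"
      unfolding f_def h_def using ne by (intro continuous_intros ajc) auto
    hence "(f \<gamma> has_integral integral {0..1} (f \<gamma>)) {0..1}"
      by (intro integrable_integral integrable_continuous_interval)
    from has_integral_mult_right[OF has_integral_linear[OF this bounded_linear_Re], of 2]
    have I1: "((\<lambda>t. 2 * Re (f \<gamma> t)) has_integral 2 * Re (integral {0..1} (f \<gamma>))) {0..1}"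
      by (simp add: o_def)
    have c1: "continuous_on {0..1} (speed \<gamma>)" by (intro continuous_intros ajc)
    have c2: "continuous_on {0..1} (\<lambda>t. speed \<gamma> t / (norm (\<gamma> t - a))\<^sup>2)"
      using ne by (intro continuous_intros ajc) auto
    have I2: "((\<lambda>t. speed \<gamma> t - q * (speed \<gamma> t / (norm (\<gamma> t - a))\<^sup>2)) has_integral
        curve_length \<gamma> - q * P \<gamma>) {0..1}"
      unfolding P_def
      by (intro has_integral_diff has_integral_mult_right integrable_integral
          integrable_continuous_interval c1 c2)
    have "speed \<gamma> t - q * (speed \<gamma> t / (norm (\<gamma> t - a))\<^sup>2) \<le> 2 * Re (f \<gamma> t)" for t
    proof -
      define w where "w = \<gamma> t - cnj c"
      define b where "b = a - cnj c"
      have wb: "w \<noteq> b" "w - b = \<gamma> t - a" using ne[of t] by (auto simp: w_def b_def)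
      have "r\<^sup>2 \<le> (norm w)\<^sup>2" using r(2)[OF fr[of t]] r(1) by (intro power_mono) (auto simp: w_def)
      hence "((norm b)\<^sup>2 - (norm w)\<^sup>2) / (norm (w - b))\<^sup>2 \<le> q / (norm (w - b))\<^sup>2"
        by (intro divide_right_mono) (auto simp: q_def b_def)
      hence "1 - q / (norm (w - b))\<^sup>2 \<le> 2 * Re (w / (w - b))"
        unfolding two_Re_divide_diff[OF wb(1)] by simp
      hence *: "(1 - q / (norm (w - b))\<^sup>2) * speed \<gamma> t \<le> 2 * Re (w / (w - b)) * speed \<gamma> t"
        by (intro mult_right_mono) auto
      have "f \<gamma> t = cnj (w / (w - b)) * of_real (speed \<gamma> t)"
        unfolding f_def h_def wb(2) by (simp add: w_def)
      moreover have "Re (cnj z * of_real s) = Re z * s" for z s by simp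
      ultimately have "Re (f \<gamma> t) = Re (w / (w - b)) * speed \<gamma> t" by (simp only:)
      with * show ?thesis unfolding wb(2) by (simp add: algebra_simps)
    qed
    hence "curve_length \<gamma> - q * P \<gamma> \<le> 2 * Re (integral {0..1} (f \<gamma>))"
      by (intro has_integral_le[OF I2 I1]) auto
    thus ?thesis using set_lebesgue_integral_continuous[OF cont] by simp
  qed
  have "(\<Sum>\<gamma>\<leftarrow>\<gamma>s. curve_length \<gamma>) - q * (\<Sum>\<gamma>\<leftarrow>\<gamma>s. P \<gamma>) = (\<Sum>\<gamma>\<leftarrow>\<gamma>s. curve_length \<gamma> - q * P \<gamma>)"
    by (simp add: sum_list_subtractf sum_list_const_mult)
  also have "\<dots> \<le> (\<Sum>\<gamma>\<leftarrow>\<gamma>s. 2 * Re (set_lebesgue_integral lborel {0..1} (f \<gamma>)))"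
    by (intro sum_list_mono ineq)
  also have "\<dots> = 2 * Re (\<Sum>\<gamma>\<leftarrow>\<gamma>s. set_lebesgue_integral lborel {0..1} (f \<gamma>))"
    by (induction \<gamma>s) auto
  also have "(\<Sum>\<gamma>\<leftarrow>\<gamma>s. set_lebesgue_integral lborel {0..1} (f \<gamma>)) = 0"
    using zero by (simp add: bdry_inner_def bdry_integral_def f_def)
  finally show ?thesis by (simp add: q_def P_def)
qed

lemma curve_length_pos:
  assumes "analytic_jordan_curve \<gamma>"
  shows "curve_length \<gamma> > 0"
proof -
  have "integral {0..1::real} (\<lambda>_. 0) < curve_length \<gamma>"
    using analytic_jordan_curve_speed_pos[OF assms]
    by (intro integral_less_real continuous_intros assms) auto
  thus ?thesis by simp
qed

lemma total_length_pos:
  assumes "analytic_boundary_param \<Omega> \<gamma>s"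
  shows "(\<Sum>\<gamma>\<leftarrow>\<gamma>s. curve_length \<gamma>) > 0"
proof -
  obtain \<beta> \<beta>s where \<gamma>s: "\<gamma>s = \<beta> # \<beta>s"
    using assms by (cases \<gamma>s) (auto simp: analytic_boundary_param_def)
  have pos: "curve_length \<gamma> > 0" if "\<gamma> \<in> set \<gamma>s" for \<gamma>
    using that assms curve_length_pos analytic_boundary_param_setD(1) by blast
  have "(\<Sum>\<gamma>\<leftarrow>\<beta>s. curve_length \<gamma>) \<ge> 0"
    using pos by (intro sum_list_nonneg) (auto simp: \<gamma>s intro: less_imp_le)
  moreover have "curve_length \<beta> > 0" using pos by (simp add: \<gamma>s)
  ultimately show ?thesis by (simp add: \<gamma>s)
qed

lemma nearest_frontier_point_param:
  assumes param: "analytic_boundary_param \<Omega> \<gamma>s"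
  obtains i t1 where "i < length \<gamma>s" "1/2 \<le> t1" "t1 \<le> 3/2"
    "\<forall>w\<in>frontier \<Omega>. norm ((\<gamma>s ! i) t1 - z0) \<le> norm (w - z0)"
proof -
  have ne: "frontier \<Omega> \<noteq> {}"
    using param analytic_boundary_paramD(2)[OF param, of 0] by (auto simp: analytic_boundary_param_def)
  obtain p where p: "p \<in> frontier \<Omega>" "\<And>w. w \<in> frontier \<Omega> \<Longrightarrow> dist z0 p \<le> dist z0 w"
    using distance_attains_inf[OF frontier_closed ne] by metis
  then obtain \<beta> t where "\<beta> \<in> set \<gamma>s" "t \<in> {0..1}" "p = \<beta> t"
    using param unfolding analytic_boundary_param_def by auto
  then obtain i where i: "i < length \<gamma>s" "p = (\<gamma>s ! i) t" "t \<in> {0..1}"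
    by (metis in_set_conv_nth)
  \<comment> \<open>The shift by a period makes \<open>t1 - 1/2\<close>, the start of the window
    centred at \<open>t1\<close>, lie in the unit interval, as \<open>integral_unit_periodic\<close>
    requires.\<close>
  define t1 where "t1 = (if t < 1/2 then t + 1 else t)"
  have "(\<gamma>s ! i) t1 = p"
    using i analytic_jordan_curve_period[OF analytic_boundary_paramD(1)[OF param i(1)]]
    by (simp add: t1_def)
  moreover have "1/2 \<le> t1" "t1 \<le> 3/2" using i(3) by (auto simp: t1_def)
  ultimately show ?thesis using p(2) i(1)
    by (intro that[of i t1]) (auto simp: dist_norm norm_minus_commute)
qed

text \<open>The degenerate case \<open>\<gamma> t1 = z0\<close> has to be covered, since positivity
  of the distance is known only after the length bound. There any unit normal will do, and the
  velocity is rotated by a right angle.\<close>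

lemma unit_normal_through:
  assumes \<gamma>: "analytic_jordan_curve \<gamma>" and "inner (\<gamma> t1 - z0) (velocity \<gamma> t1) = 0"
  obtains n where "norm n = 1" "inner n (velocity \<gamma> t1) = 0" "\<gamma> t1 - z0 = norm (\<gamma> t1 - z0) *\<^sub>R n"
proof (cases "\<gamma> t1 = z0")
  case True
  define v where "v = velocity \<gamma> t1"
  have "v \<noteq> 0" using analytic_jordan_curve_speed_pos[OF \<gamma>, of t1] by (simp add: v_def)
  have "norm (\<i> * v /\<^sub>R norm v) = 1" using \<open>v \<noteq> 0\<close> by (simp add: norm_mult)
  moreover have "inner (\<i> * v /\<^sub>R norm v) v = 0" by (simp add: inner_complex_def)
  ultimately show ?thesis using True by (intro that[of "\<i> * v /\<^sub>R norm v"]) (auto simp: v_def)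
next
  case False
  thus ?thesis using assms(2) that[of "(\<gamma> t1 - z0) /\<^sub>R norm (\<gamma> t1 - z0)"] by simp
qed

text \<open>With the pole \<open>a = p + \<sigma> *\<^sub>R n\<close> the prefactor is
  \<open>2 * r * \<sigma> + \<sigma>\<^sup>2\<close>, while the kernel mass is at most
  \<open>\<kappa> * pi / \<bar>\<sigma>\<bar> + C\<close>. Their product is bounded by a quantity
  tending to \<open>2 * r * \<kappa> * pi\<close> as \<open>\<sigma>\<close> tends to zero, and then
  \<open>\<kappa>\<close> decreases to one.\<close>

lemma szego_constant_length_le:
  assumes dom: "bounded_domain \<Omega>" and param: "analytic_boundary_param \<Omega> \<gamma>s"
    and proj: "is_szego_projection \<Omega> \<gamma>s cnj (\<lambda>_. c)"
  obtains p where "p \<in> frontier \<Omega>" "\<forall>w\<in>frontier \<Omega>. norm (p - cnj c) \<le> norm (w - cnj c)"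
    "(\<Sum>\<gamma>\<leftarrow>\<gamma>s. curve_length \<gamma>) \<le> 2 * pi * norm (p - cnj c)"
proof -
  define L where "L = (\<Sum>\<gamma>\<leftarrow>\<gamma>s. curve_length \<gamma>)"
  obtain i t1 where i: "i < length \<gamma>s" and t1: "1/2 \<le> t1" "t1 \<le> 3/2"
    and near: "\<forall>w\<in>frontier \<Omega>. norm ((\<gamma>s ! i) t1 - cnj c) \<le> norm (w - cnj c)"
    by (rule nearest_frontier_point_param[OF param])
  define \<gamma> where "\<gamma> = \<gamma>s ! i"
  have ajc: "analytic_jordan_curve \<gamma>" and fr: "\<And>t. \<gamma> t \<in> frontier \<Omega>"
    using analytic_boundary_paramD[OF param i] by (auto simp: \<gamma>_def)
  define p where "p = \<gamma> t1"
  define r where "r = norm (p - cnj c)"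
  have r: "r \<ge> 0" "\<And>w. w \<in> frontier \<Omega> \<Longrightarrow> r \<le> norm (w - cnj c)"
    using near by (auto simp: r_def p_def \<gamma>_def)
  have "inner (\<gamma> t1 - cnj c) (velocity \<gamma> t1) = 0"
    using near fr by (intro nearest_point_normal[OF ajc]) (auto simp: \<gamma>_def)
  from unit_normal_through[OF ajc this] obtain n
    where n: "norm n = 1" "inner n (velocity \<gamma> t1) = 0" "p - cnj c = r *\<^sub>R n"
    unfolding r_def p_def by blast
  have le: "L \<le> 2 * r * (\<kappa> * pi)" if \<kappa>: "\<kappa> > 1" for \<kappa>
  proof (rule ccontr)
    assume "\<not> L \<le> 2 * r * (\<kappa> * pi)"
    hence less: "2 * r * (\<kappa> * pi) < L" by simp
    obtain C where C: "\<forall>\<^sub>F \<sigma> in at 0. (\<Sum>\<gamma>\<leftarrow>\<gamma>s. integral {0..1}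
        (\<lambda>t. speed \<gamma> t / (norm (\<gamma> t - (p + \<sigma> *\<^sub>R n)))\<^sup>2)) \<le> \<kappa> * pi / \<bar>\<sigma>\<bar> + C"
      unfolding p_def \<gamma>_def
      by (rule total_poisson_mass_bound[OF param i n(1,2)[unfolded \<gamma>_def] \<kappa> t1])
    have "((\<lambda>\<sigma>. (2 * r + \<bar>\<sigma>\<bar>) * (\<kappa> * pi) + (2 * r * \<bar>\<sigma>\<bar> + \<sigma>\<^sup>2) * C) \<longlongrightarrow> 2 * r * (\<kappa> * pi)) (at 0)"
      by (auto intro!: tendsto_eq_intros)
    hence small: "\<forall>\<^sub>F \<sigma> in at 0. (2 * r + \<bar>\<sigma>\<bar>) * (\<kappa> * pi) + (2 * r * \<bar>\<sigma>\<bar> + \<sigma>\<^sup>2) * C < L"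
      using less by (rule order_tendstoD)
    have nz: "\<forall>\<^sub>F \<sigma> in at 0. \<sigma> \<noteq> (0::real)" by (simp add: eventually_at_filter)
    have "\<exists>\<^sub>F \<sigma> in at 0. p + \<sigma> *\<^sub>R n \<notin> closure \<Omega>"
      unfolding p_def \<gamma>_def by (rule normal_leaves_closure[OF dom param i n(1,2)[unfolded \<gamma>_def]])
    \<comment> \<open>Poles off the closure occur for arbitrarily small \<open>\<sigma>\<close>,
      whereas the estimates hold for all small nonzero \<open>\<sigma>\<close>; hence one
      \<open>\<sigma>\<close> satisfies everything at once.\<close>
    from frequently_eventually_frequently[OF this eventually_conj[OF C eventually_conj[OF small nz]]]
    obtain \<sigma> where out: "p + \<sigma> *\<^sub>R n \<notin> closure \<Omega>" and \<sigma>: "\<sigma> \<noteq> 0"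
      and mass: "(\<Sum>\<gamma>\<leftarrow>\<gamma>s. integral {0..1}
        (\<lambda>t. speed \<gamma> t / (norm (\<gamma> t - (p + \<sigma> *\<^sub>R n)))\<^sup>2)) \<le> \<kappa> * pi / \<bar>\<sigma>\<bar> + C" (is "?M \<le> _")
      and sm: "(2 * r + \<bar>\<sigma>\<bar>) * (\<kappa> * pi) + (2 * r * \<bar>\<sigma>\<bar> + \<sigma>\<^sup>2) * C < L"
      using frequently_ex by force
    have "p + \<sigma> *\<^sub>R n - cnj c = (r + \<sigma>) *\<^sub>R n"
      using n(3) by (simp add: algebra_simps)
    hence nrm: "(norm (p + \<sigma> *\<^sub>R n - cnj c))\<^sup>2 - r\<^sup>2 = 2 * r * \<sigma> + \<sigma>\<^sup>2"
      by (simp only: norm_scaleR n(1)) (simp add: power2_eq_square algebra_simps)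
    \<comment> \<open>A function that is not integrable has integral zero by convention, so
      nonnegativity holds for all \<open>\<gamma>\<close> and \<open>z\<close>.\<close>
    have "integral {0..1} (\<lambda>t. speed \<gamma> t / (norm (\<gamma> t - z))\<^sup>2) \<ge> 0" for \<gamma> z
      by (cases "(\<lambda>t. speed \<gamma> t / (norm (\<gamma> t - z))\<^sup>2) integrable_on {0..1}")
         (auto intro!: integral_nonneg simp: not_integrable_integral)
    hence M0: "?M \<ge> 0" by (intro sum_list_nonneg) auto
    have "L \<le> (2 * r * \<sigma> + \<sigma>\<^sup>2) * ?M"
      using length_le_poisson_mass[OF param proj out r] unfolding L_def nrm .
    \<comment> \<open>The sign of \<open>\<sigma>\<close> is unknown, because the domain may lie on
      either side of the boundary relative to \<open>n\<close>.\<close>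
    also have "\<dots> \<le> (2 * r * \<bar>\<sigma>\<bar> + \<sigma>\<^sup>2) * ?M"
      using M0 r(1) by (intro mult_right_mono add_right_mono mult_left_mono) auto
    also have "\<dots> \<le> (2 * r * \<bar>\<sigma>\<bar> + \<sigma>\<^sup>2) * (\<kappa> * pi / \<bar>\<sigma>\<bar> + C)"
      using mass r(1) by (intro mult_left_mono) auto
    also have "\<dots> = (2 * r + \<bar>\<sigma>\<bar>) * (\<kappa> * pi) + (2 * r * \<bar>\<sigma>\<bar> + \<sigma>\<^sup>2) * C"
    proof -
      have "2 * r * \<bar>\<sigma>\<bar> + \<sigma>\<^sup>2 = (2 * r + \<bar>\<sigma>\<bar>) * \<bar>\<sigma>\<bar>"
        by (simp add: distrib_right power2_eq_square)
      thus ?thesis using \<sigma> by (simp add: distrib_left)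
    qed
    finally show False using sm by simp
  qed
  have "L \<le> 2 * pi * r"
  proof (rule ccontr)
    assume "\<not> L \<le> 2 * pi * r"
    \<comment> \<open>For positive \<open>r\<close> the choice
      \<open>\<kappa> = L' / (2 * pi * r)\<close> yields \<open>L \<le> L'\<close>, a contradiction;
      for \<open>r = 0\<close> any \<open>\<kappa>\<close> gives \<open>L \<le> 0\<close>.\<close>
    then obtain L' where L': "2 * pi * r < L'" "L' < L" using dense[of "2 * pi * r" L] by auto
    show False
    proof (cases "r = 0")
      case True
      thus False using le[of 2] L' by simp
    next
      case False
      hence "r > 0" using r(1) by simp
      hence "L' / (2 * pi * r) > 1" using L'(1) by (simp add: field_simps)
      from le[OF this] show False using L' \<open>r > 0\<close> by (simp add: field_simps)
    qed
  qed
  thus ?thesis using fr r by (intro that[of p]) (auto simp: L_def r_def p_def)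
qed

section \<open>Separation of the plane by the boundary curves\<close>

text \<open>Induction on Janiszewski's theorem: a newly added set is disjoint from the previous
  union, and the empty intersection is connected.\<close>

lemma Janiszewski_finite_Union:
  fixes a b :: complex and n :: nat
  assumes "\<And>j. j < n \<Longrightarrow> compact (P j)"
    and "\<And>j k. j < n \<Longrightarrow> k < n \<Longrightarrow> j \<noteq> k \<Longrightarrow> P j \<inter> P k = {}"
    and "\<And>j. j < n \<Longrightarrow> connected_component (- P j) a b"
  shows "connected_component (- (\<Union>j<n. P j)) a b"
  using assms
proof (induction n)
  case 0
  show ?case unfolding connected_component_def using connected_UNIV by auto
next
  case (Suc n)
  have "connected_component (- (P n \<union> (\<Union>j<n. P j))) a b"
  proof (rule Janiszewski)
    show "compact (P n)" using Suc.prems by simp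
    show "closed (\<Union>j<n. P j)"
      using Suc.prems(1) by (intro closed_UN) (auto intro: compact_imp_closed)
    have "P n \<inter> P j = {}" if "j < n" for j using Suc.prems(2)[of n j] that by simp
    hence "P n \<inter> (\<Union>j<n. P j) = {}" by blast
    thus "connected (P n \<inter> (\<Union>j<n. P j))" by simp
    show "connected_component (- P n) a b" using Suc.prems(3) by simp
    show "connected_component (- (\<Union>j<n. P j)) a b" by (rule Suc.IH) (use Suc.prems in auto)
  qed
  thus ?case by (simp add: lessThan_Suc)
qed

text \<open>If \<open>z0\<close> were outside every boundary curve, no single curve would separate
  it from a far point \<open>b\<close>, and hence neither would their union. But that union is the
  frontier, which any connected set from the domain to \<open>b\<close> must meet.\<close>

lemma domain_point_inside_some_curve:
  assumes dom: "bounded_domain \<Omega>" and param: "analytic_boundary_param \<Omega> \<gamma>s" and z0: "z0 \<in> \<Omega>"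
  shows "\<exists>i<length \<gamma>s. z0 \<in> inside (path_image (\<gamma>s ! i))"
proof (rule ccontr)
  assume neg: "\<not> ?thesis"
  hence notin: "z0 \<notin> inside (path_image (\<gamma>s ! i))" if "i < length \<gamma>s" for i using that by blast
  define P where "P = (\<lambda>j. path_image (\<gamma>s ! j))"
  have "bounded (closure \<Omega>)" using dom by (auto simp: bounded_domain_def)
  then obtain B where B: "closure \<Omega> \<subseteq> ball 0 B" using bounded_subset_ballD by blast
  define b where "b = complex_of_real \<bar>B\<bar>"
  have b: "b \<notin> ball 0 B" by (simp add: b_def)
  have frP: "frontier \<Omega> = (\<Union>j<length \<gamma>s. P j)"
  proof -
    have "set \<gamma>s = (\<lambda>j. \<gamma>s ! j) ` {..<length \<gamma>s}" by (auto simp: set_conv_nth)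
    thus ?thesis using param by (auto simp: analytic_boundary_param_def P_def path_image_def)
  qed
  have op: "open \<Omega>" using dom by (simp add: bounded_domain_def)
  hence z0fr: "z0 \<notin> frontier \<Omega>" using z0 by (simp add: frontier_def interior_open)
  have "connected_component (- (\<Union>j<length \<gamma>s. P j)) z0 b"
  proof (rule Janiszewski_finite_Union)
    fix j assume j: "j < length \<gamma>s"
    note ajc = analytic_boundary_paramD(1)[OF param j]
    note J = Jordan_inside_outside[OF analytic_jordan_curve_paths(2,3)[OF ajc]]
    show "compact (P j)"
      using analytic_jordan_curve_paths(2)[OF ajc] by (simp add: P_def compact_simple_path_image)
    have sub: "P j \<subseteq> ball 0 B" using frP B j by (auto simp: frontier_def)
    hence "b \<in> outside (P j)" using outside_subset_convex[OF convex_ball sub] b by blast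
    moreover have "z0 \<in> outside (P j)"
      using notin[OF j] z0fr j J unfolding frP P_def by blast
    moreover have "connected (outside (P j))" "outside (P j) \<subseteq> - P j"
      using J outside_no_overlap[of "P j"] unfolding P_def by blast+
    ultimately show "connected_component (- P j) z0 b"
      unfolding connected_component_def by blast
    show "P j \<inter> P k = {}" if "k < length \<gamma>s" "j \<noteq> k" for k
      using param j that by (auto simp: analytic_boundary_param_def P_def path_image_def)
  qed
  then obtain T where T: "connected T" "T \<subseteq> - frontier \<Omega>" "z0 \<in> T" "b \<in> T"
    unfolding frP connected_component_def by blast
  have "b \<notin> \<Omega>" using b B closure_subset by blast
  hence "T \<inter> frontier \<Omega> \<noteq> {}"
    using connected_Int_frontier[OF T(1), of \<Omega>] T(3,4) z0 by blast
  thus False using T(2) by blast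
qed

section \<open>Equality in the length bound forces a circle\<close>

text \<open>The winding number about an inside point has modulus one, so the integral of
  \<open>velocity \<gamma> t / (\<gamma> t - z)\<close> has modulus \<open>2 * pi\<close>; the
  triangle inequality for integrals does the rest.\<close>

lemma two_pi_le_angular_length:
  assumes \<gamma>: "analytic_jordan_curve \<gamma>" and z: "z \<in> inside (path_image \<gamma>)"
  shows "2 * pi \<le> integral {0..1} (\<lambda>t. speed \<gamma> t / norm (\<gamma> t - z))"
proof -
  have nz: "z \<notin> path_image \<gamma>" using z inside_no_overlap[of "path_image \<gamma>"] by blast
  have ne: "\<gamma> t \<noteq> z" for t
    using nz analytic_jordan_curve_mem[OF \<gamma>, of t] by (auto simp: path_image_def)
  define f where "f = (\<lambda>t. 1 / (\<gamma> t - z) * velocity \<gamma> t)"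
  have cf: "continuous_on {0..1} f"
    unfolding f_def using ne by (intro continuous_intros \<gamma>) auto
  have "1 = norm (winding_number \<gamma> z)"
    using simple_closed_path_norm_winding_number_inside[OF analytic_jordan_curve_paths(2)[OF \<gamma>] z] by simp
  also have "winding_number \<gamma> z = 1 / (2 * pi * \<i>) * contour_integral \<gamma> (\<lambda>w. 1 / (w - z))"
    using analytic_jordan_curve_paths(1)[OF \<gamma>] nz by (rule winding_number_valid_path)
  also have "contour_integral \<gamma> (\<lambda>w. 1 / (w - z)) = integral {0..1} f"
    by (simp add: contour_integral_integral f_def)
  finally have "2 * pi = norm (integral {0..1} f)"
    by (simp add: norm_mult norm_divide field_simps)
  also have "\<dots> \<le> integral {0..1} (\<lambda>t. speed \<gamma> t / norm (\<gamma> t - z))"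
  proof (rule Henstock_Kurzweil_Integration.integral_norm_bound_integral)
    show "(\<lambda>t. speed \<gamma> t / norm (\<gamma> t - z)) integrable_on {0..1}"
      using ne by (intro integrable_continuous_interval continuous_intros \<gamma>) auto
  qed (use cf in \<open>auto intro: integrable_continuous_interval simp: f_def norm_mult norm_divide\<close>)
  finally show ?thesis .
qed

text \<open>The ball and the complement of the closed ball are connected and miss the frontier, so
  each lies inside or outside the domain. The centre places the first inside, boundedness places the
  second outside, and openness removes the circle itself.\<close>

lemma domain_eq_ball:
  assumes dom: "bounded_domain \<Omega>" and z0: "z0 \<in> \<Omega>" and r: "r > 0"
    and fr: "frontier \<Omega> \<subseteq> sphere z0 r"
  shows "\<Omega> = ball z0 r"
proof
  have op: "open \<Omega>" "bounded \<Omega>" using dom by (auto simp: bounded_domain_def)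
  show "ball z0 r \<subseteq> \<Omega>"
  proof (rule ccontr)
    assume "\<not> ball z0 r \<subseteq> \<Omega>"
    moreover have "z0 \<in> ball z0 r \<inter> \<Omega>" using z0 r by simp
    ultimately have "ball z0 r \<inter> frontier \<Omega> \<noteq> {}"
      using connected_Int_frontier[OF connected_ball, of z0 r \<Omega>] by blast
    thus False using fr by auto
  qed
  have "\<Omega> \<subseteq> cball z0 r"
  proof (rule ccontr)
    assume "\<not> \<Omega> \<subseteq> cball z0 r"
    hence "- cball z0 r \<inter> \<Omega> \<noteq> {}" by blast
    moreover have "- cball z0 r - \<Omega> \<noteq> {}"
    proof
      assume "- cball z0 r - \<Omega> = {}"
      hence "- cball z0 r \<subseteq> \<Omega>" by blast
      hence "bounded (- cball z0 r)" using op bounded_subset by blast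
      hence "bounded (- cball z0 r \<union> cball z0 r)" using bounded_Un bounded_cball by blast
      thus False by (simp add: Un_commute not_bounded_UNIV)
    qed
    moreover have "connected (- cball z0 r)"
      by (intro connected_complement_bounded_convex) auto
    ultimately have "- cball z0 r \<inter> frontier \<Omega> \<noteq> {}" by (intro connected_Int_frontier)
    thus False using fr by auto
  qed
  hence "\<Omega> \<subseteq> interior (cball z0 r)" using op(1) interior_maximal by blast
  thus "\<Omega> \<subseteq> ball z0 r" by simp
qed

text \<open>For the curve around \<open>z0\<close> its length is at least \<open>2 * pi * r\<close>
  by winding and at most the total length, which is at most \<open>2 * pi * r\<close>. Equality
  leaves room for no second curve and keeps this one at constant distance \<open>r\<close> from
  \<open>z0\<close>.\<close>

lemma szego_constant_imp_ball:
  assumes dom: "bounded_domain \<Omega>" and param: "analytic_boundary_param \<Omega> \<gamma>s"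
    and proj: "is_szego_projection \<Omega> \<gamma>s cnj (\<lambda>_. c)"
  shows "\<exists>r>0. \<Omega> = ball (cnj c) r"
proof -
  define z0 where "z0 = cnj c"
  define L where "L = (\<Sum>\<gamma>\<leftarrow>\<gamma>s. curve_length \<gamma>)"
  have L: "L > 0" using total_length_pos[OF param] by (simp add: L_def)
  obtain p where p: "p \<in> frontier \<Omega>" "\<forall>w\<in>frontier \<Omega>. norm (p - z0) \<le> norm (w - z0)"
    "L \<le> 2 * pi * norm (p - z0)"
    unfolding L_def z0_def by (rule szego_constant_length_le[OF dom param proj])
  define r where "r = norm (p - z0)"
  have r: "r > 0" using p(3) L pi_gt_zero by (auto simp: r_def)
  have "z0 \<in> closure \<Omega>"
  proof (rule ccontr)
    assume "z0 \<notin> closure \<Omega>"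
    \<comment> \<open>With pole \<open>z0\<close> and \<open>r = 0\<close> the prefactor vanishes,
      so the total length would be at most zero.\<close>
    from length_le_poisson_mass[OF param proj this, of 0] show False
      using L by (simp add: z0_def L_def)
  qed
  moreover have "z0 \<notin> frontier \<Omega>" using p(2) r by (auto simp: r_def)
  ultimately have z0: "z0 \<in> \<Omega>" using closure_Un_frontier[of \<Omega>] by blast
  obtain i where i: "i < length \<gamma>s" "z0 \<in> inside (path_image (\<gamma>s ! i))"
    using domain_point_inside_some_curve[OF dom param z0] by blast
  define \<gamma> where "\<gamma> = \<gamma>s ! i"
  note ajc = analytic_boundary_paramD(1)[OF param i(1), folded \<gamma>_def]
  have fr: "\<gamma> t \<in> frontier \<Omega>" for t using analytic_boundary_paramD(2)[OF param i(1)] by (simp add: \<gamma>_def)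
  have rle: "r \<le> norm (\<gamma> t - z0)" for t using p(2) fr by (simp add: r_def)
  have pos: "norm (\<gamma> t - z0) > 0" for t using rle[of t] r by linarith
  \<comment> \<open>The pointwise gap in the comparison of arclength with \<open>r\<close> times the
    angular bound. It is nonnegative and continuous, so a vanishing integral makes it vanish
    everywhere on the period.\<close>
  define g where "g = (\<lambda>t. speed \<gamma> t - r * (speed \<gamma> t / norm (\<gamma> t - z0)))"
  have contg: "continuous_on {0..1} g"
    unfolding g_def using pos by (intro continuous_intros ajc) auto
  have g0: "g t \<ge> 0" for t
  proof -
    have "r / norm (\<gamma> t - z0) \<le> 1" using rle[of t] pos[of t] by simp
    hence "speed \<gamma> t * (r / norm (\<gamma> t - z0)) \<le> speed \<gamma> t * 1" by (intro mult_left_mono) auto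
    thus ?thesis by (simp add: g_def mult.commute)
  qed
  have "integral {0..1} g = curve_length \<gamma> - r * integral {0..1} (\<lambda>t. speed \<gamma> t / norm (\<gamma> t - z0))"
    unfolding g_def using pos
    by (intro integral_unique has_integral_diff has_integral_mult_right integrable_integral
        integrable_continuous_interval continuous_intros ajc) auto
  also have "\<dots> \<le> curve_length \<gamma> - r * (2 * pi)"
    using two_pi_le_angular_length[OF ajc, of z0] i(2) r by (simp add: \<gamma>_def)
  finally have gle: "integral {0..1} g \<le> curve_length \<gamma> - 2 * pi * r" by (simp add: mult_ac)
  have gge: "integral {0..1} g \<ge> 0"
    using g0 contg by (intro integral_nonneg integrable_continuous_interval) auto
  have Lsum: "L = curve_length \<gamma> + (\<Sum>j\<in>{..<length \<gamma>s} - {i}. curve_length (\<gamma>s ! j))"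
    using i(1) by (simp add: L_def sum_list_sum_nth atLeast0LessThan sum.remove[of _ i] \<gamma>_def)
  have Lj: "curve_length (\<gamma>s ! j) > 0" if "j < length \<gamma>s" for j
    using curve_length_pos analytic_boundary_paramD(1)[OF param that] .
  have only: "j = i" if j: "j < length \<gamma>s" for j
  proof (rule ccontr)
    assume "j \<noteq> i"
    hence "(\<Sum>j\<in>{..<length \<gamma>s} - {i}. curve_length (\<gamma>s ! j)) > 0"
      using j Lj by (intro sum_pos) auto
    thus False using gle gge Lsum p(3) by (simp add: r_def)
  qed
  have "(\<Sum>j\<in>{..<length \<gamma>s} - {i}. curve_length (\<gamma>s ! j)) \<ge> 0"
    using Lj by (intro sum_nonneg) (auto intro: less_imp_le)
  hence "integral {0..1} g = 0" using gle gge Lsum p(3) by (simp add: r_def)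
  hence gz: "g t = 0" if "t \<in> {0..1}" for t
    using integral_eq_0_iff[OF contg] g0 that by auto
  have on: "norm (\<gamma> t - z0) = r" if "t \<in> {0..1}" for t
    using gz[OF that] analytic_jordan_curve_speed_pos[OF ajc, of t] pos[of t]
    by (simp add: g_def field_simps)
  have "frontier \<Omega> \<subseteq> sphere z0 r"
  proof
    fix w assume "w \<in> frontier \<Omega>"
    then obtain \<beta> t where "\<beta> \<in> set \<gamma>s" "t \<in> {0..1}" "w = \<beta> t"
      using param unfolding analytic_boundary_param_def by auto
    moreover from this have "\<beta> = \<gamma>" using only by (metis in_set_conv_nth \<gamma>_def)
    ultimately show "w \<in> sphere z0 r" using on by (simp add: dist_norm norm_minus_commute)
  qed
  from domain_eq_ball[OF dom z0 r this] r show ?thesis unfolding z0_def by blast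
qed

subsection \<open>The disc\<close>

lemma continuous_nonzero_constant_sign:
  fixes s :: "real \<Rightarrow> real"
  assumes "continuous_on {a..b} s" "\<And>t. t \<in> {a..b} \<Longrightarrow> s t \<noteq> 0"
  shows "(\<forall>t\<in>{a..b}. s t > 0) \<or> (\<forall>t\<in>{a..b}. s t < 0)"
proof (rule ccontr)
  assume "\<not> ?thesis"
  then obtain x y where xy: "x \<in> {a..b}" "y \<in> {a..b}" "s x \<le> 0" "0 \<le> s y" by force
  have "connected (s ` {a..b})" using assms(1) by (intro connected_continuous_image) auto
  hence "0 \<in> s ` {a..b}" using connectedD_interval xy by blast
  thus False using assms(2) by auto
qed

text \<open>The velocity is orthogonal to the radius, so it equals \<open>\<i> * s t\<close> times
  the radius vector with a real nonzero continuous \<open>s\<close>. The sign of \<open>s\<close> is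
  the orientation; being constant, it makes the factor \<open>k\<close> constant, namely
  \<open>- \<i> * r\<close> or \<open>\<i> * r\<close>.\<close>

lemma circle_arclength_eq_scaled_velocity:
  assumes \<gamma>: "analytic_jordan_curve \<gamma>" and on: "\<And>t. norm (\<gamma> t - z0) = r" and r: "r > 0"
  shows "\<exists>k. \<forall>t\<in>{0..1}. (\<gamma> t - z0) * complex_of_real (speed \<gamma> t) = k * velocity \<gamma> t"
proof -
  define s where "s = (\<lambda>t. Im (velocity \<gamma> t * cnj (\<gamma> t - z0)) / r\<^sup>2)"
  have v: "velocity \<gamma> t = \<i> * of_real (s t) * (\<gamma> t - z0)" for t
  proof -
    have "inner (\<gamma> t - z0) (velocity \<gamma> t) = 0" by (rule nearest_point_normal[OF \<gamma>]) (simp add: on)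
    hence "Re (velocity \<gamma> t * cnj (\<gamma> t - z0)) = 0" by (simp add: inner_complex_def algebra_simps)
    hence "velocity \<gamma> t * cnj (\<gamma> t - z0) = \<i> * of_real (s t * r\<^sup>2)"
      using r by (simp add: s_def complex_eq_iff)
    also have "complex_of_real (s t * r\<^sup>2) = of_real (s t) * ((\<gamma> t - z0) * cnj (\<gamma> t - z0))"
      unfolding complex_norm_square[symmetric] on by simp
    finally have "velocity \<gamma> t * cnj (\<gamma> t - z0) = (\<i> * of_real (s t) * (\<gamma> t - z0)) * cnj (\<gamma> t - z0)"
      by (simp add: mult_ac)
    moreover have "cnj (\<gamma> t - z0) \<noteq> 0" using on[of t] r by auto
    ultimately show ?thesis using mult_right_cancel by blast
  qed
  have sp: "speed \<gamma> t = \<bar>s t\<bar> * r" for t by (subst v) (simp add: norm_mult on)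
  have "s t \<noteq> 0" for t using sp[of t] analytic_jordan_curve_speed_pos[OF \<gamma>, of t] by auto
  moreover have "continuous_on {0..1} s" unfolding s_def using r by (intro continuous_intros \<gamma>) auto
  ultimately consider "\<forall>t\<in>{0..1}. s t > 0" | "\<forall>t\<in>{0..1}. s t < 0"
    using continuous_nonzero_constant_sign by blast
  thus ?thesis
  proof cases
    case 1
    have "(\<gamma> t - z0) * complex_of_real (speed \<gamma> t) = (- \<i> * of_real r) * velocity \<gamma> t" if "t \<in> {0..1}" for t
      unfolding sp by (subst v) (use 1 that in \<open>simp add: abs_of_pos algebra_simps\<close>)
    thus ?thesis by blast
  next
    case 2
    have "(\<gamma> t - z0) * complex_of_real (speed \<gamma> t) = (\<i> * of_real r) * velocity \<gamma> t" if "t \<in> {0..1}" for t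
      unfolding sp by (subst v) (use 2 that in \<open>simp add: abs_of_neg algebra_simps\<close>)
    thus ?thesis by blast
  qed
qed

text \<open>On the circle the integrand is a constant multiple of \<open>F\<close> times
  \<open>dz\<close>, and Cauchy's theorem on the closed disc needs only continuity of
  \<open>F\<close> up to the boundary.\<close>

lemma circle_arclength_orthogonal_holomorphic:
  assumes \<gamma>: "analytic_jordan_curve \<gamma>" and on: "\<And>t. norm (\<gamma> t - z0) = r" and r: "r > 0"
    and F: "F holomorphic_on ball z0 r" "continuous_on (cball z0 r) F"
  shows "((\<lambda>t. (\<gamma> t - z0) * F (\<gamma> t) * complex_of_real (speed \<gamma> t)) has_integral 0) {0..1}"
proof -
  obtain k where k: "\<forall>t\<in>{0..1}. (\<gamma> t - z0) * complex_of_real (speed \<gamma> t) = k * velocity \<gamma> t"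
    using circle_arclength_eq_scaled_velocity[OF \<gamma> on r] by blast
  have "(F has_contour_integral 0) \<gamma>"
  proof (rule Cauchy_theorem_convex[OF F(2) convex_cball finite.emptyI])
    show "F field_differentiable at x" if "x \<in> interior (cball z0 r) - {}" for x
      using F(1) that by (auto simp: holomorphic_on_imp_differentiable_at)
    show "path_image \<gamma> \<subseteq> cball z0 r"
      using on by (auto simp: path_image_def dist_norm norm_minus_commute)
  qed (use analytic_jordan_curve_paths[OF \<gamma>] in auto)
  hence "((\<lambda>t. F (\<gamma> t) * velocity \<gamma> t) has_integral 0) {0..1}" by (simp add: has_contour_integral)
  from has_integral_mult_right[OF this, of k]
  have I: "((\<lambda>t. k * (F (\<gamma> t) * velocity \<gamma> t)) has_integral 0) {0..1}" by simp
  have "k * (F (\<gamma> t) * velocity \<gamma> t) = (\<gamma> t - z0) * F (\<gamma> t) * complex_of_real (speed \<gamma> t)"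
    if "t \<in> {0..1}" for t
    using k that by (metis mult.assoc mult.commute)
  from has_integral_eq[OF this I] show ?thesis .
qed

section \<open>Passing to the closure in L2\<close>

text \<open>Continuity of the pairing under weighted L2 approximation. In place of the
  Cauchy-Schwarz inequality, the pointwise bound
  \<open>q \<le> \<delta> + q\<^sup>2 / \<delta>\<close> on the error \<open>q\<close> is
  integrated.\<close>

lemma set_integral_zero_L2_closure:
  fixes \<phi> H :: "real \<Rightarrow> complex" and s :: "real \<Rightarrow> real"
  assumes \<phi>: "continuous_on {0..1} \<phi>" "\<And>t. norm (\<phi> t) \<le> r"
    and s: "continuous_on {0..1} s" "\<And>t. s t \<ge> 0"
    and H: "set_borel_measurable lborel {0..1} H" "set_integrable lborel {0..1} (\<lambda>t. (norm (H t))\<^sup>2 * s t)"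
    and approx: "\<And>e. e > 0 \<Longrightarrow> \<exists>G. continuous_on {0..1} G \<and>
        (LINT t:{0..1}|lborel. \<phi> t * cnj (G t) * of_real (s t)) = 0 \<and>
        (LINT t:{0..1}|lborel. (norm (H t - G t))\<^sup>2 * s t) < e"
  shows "(LINT t:{0..1}|lborel. \<phi> t * cnj (H t) * of_real (s t)) = 0"
proof -
  have r: "r \<ge> 0" using \<phi>(2)[of 0] norm_ge_zero order_trans by blast
  have meas_ind: "(\<lambda>t. indicator {0..1} t *\<^sub>R f t) \<in> borel_measurable lborel"
    if "continuous_on {0..1} f" for f :: "real \<Rightarrow> 'a::real_normed_vector"
    using borel_measurable_continuous_on_indicator[OF _ that] by simp
  have Hm: "(\<lambda>t. indicator {0..1} t *\<^sub>R H t) \<in> borel_measurable lborel"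
    using H(1) by (simp add: set_borel_measurable_def)
  have meas: "set_borel_measurable lborel {0..1} (\<lambda>t. \<psi> t * cnj (H t - G t) * of_real (s t))"
    if "continuous_on {0..1} \<psi>" "continuous_on {0..1} G" for \<psi> G :: "real \<Rightarrow> complex"
  proof -
    have "(\<lambda>t. cnj (indicator {0..1} t *\<^sub>R H t - indicator {0..1} t *\<^sub>R G t)) \<in> borel_measurable lborel"
      by (intro borel_measurable_continuous_on[of cnj] continuous_intros borel_measurable_diff Hm meas_ind that)
    moreover have "(\<lambda>t. indicator {0..1} t *\<^sub>R (\<psi> t * of_real (s t))) \<in> borel_measurable lborel"
      by (intro meas_ind continuous_intros that s)
    ultimately have "(\<lambda>t. indicator {0..1} t *\<^sub>R (\<psi> t * of_real (s t)) *
        cnj (indicator {0..1} t *\<^sub>R H t - indicator {0..1} t *\<^sub>R G t)) \<in> borel_measurable lborel"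
      by (intro borel_measurable_times)
    moreover have "indicator {0..1} t *\<^sub>R (\<psi> t * of_real (s t)) *
        cnj (indicator {0..1} t *\<^sub>R H t - indicator {0..1} t *\<^sub>R G t)
        = indicator {0..1} t *\<^sub>R (\<psi> t * cnj (H t - G t) * of_real (s t))" for t
      by (simp add: indicator_def)
    ultimately show ?thesis unfolding set_borel_measurable_def by (simp only:)
  qed
  have measn: "set_borel_measurable lborel {0..1} (\<lambda>t. (norm (H t - G t))\<^sup>2 * s t)"
    if "continuous_on {0..1} G" for G :: "real \<Rightarrow> complex"
  proof -
    have "(\<lambda>t. (norm (indicator {0..1} t *\<^sub>R H t - indicator {0..1} t *\<^sub>R G t))\<^sup>2) \<in> borel_measurable lborel"
      by (intro borel_measurable_power borel_measurable_continuous_on[of norm] continuous_on_norm_id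
          borel_measurable_diff Hm meas_ind that)
    hence "(\<lambda>t. (norm (indicator {0..1} t *\<^sub>R H t - indicator {0..1} t *\<^sub>R G t))\<^sup>2 *
        indicator {0..1} t *\<^sub>R s t) \<in> borel_measurable lborel"
      by (intro borel_measurable_times meas_ind s)
    moreover have "(norm (indicator {0..1} t *\<^sub>R H t - indicator {0..1} t *\<^sub>R G t))\<^sup>2 * indicator {0..1} t *\<^sub>R s t
        = indicator {0..1} t *\<^sub>R ((norm (H t - G t))\<^sup>2 * s t)" for t
      by (simp add: indicator_def)
    ultimately show ?thesis unfolding set_borel_measurable_def by (simp only:)
  qed
  define I where "I = (LINT t:{0..1}|lborel. \<phi> t * cnj (H t) * of_real (s t))"
  define S where "S = (LINT t:{0..1}|lborel. s t)"
  have ints: "set_integrable lborel {0..1} s" using s(1) by (rule borel_integrable_atLeastAtMost')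
  have "norm I \<le> \<delta> * (r * (S + 1))" if \<delta>: "\<delta> > 0" for \<delta>
  proof -
    \<comment> \<open>The squared error is required to be below the square of
      \<open>\<delta>\<close>, so that after division by \<open>\<delta>\<close> both terms of the
      bound are of order \<open>\<delta>\<close>.\<close>
    have "\<delta>\<^sup>2 > 0" using \<delta> by simp
    then obtain G where G: "continuous_on {0..1} G"
        "(LINT t:{0..1}|lborel. \<phi> t * cnj (G t) * of_real (s t)) = 0"
        "(LINT t:{0..1}|lborel. (norm (H t - G t))\<^sup>2 * s t) < \<delta>\<^sup>2"
      using approx by blast
    have intG2: "set_integrable lborel {0..1} (\<lambda>t. (norm (G t))\<^sup>2 * s t)"
      by (intro borel_integrable_atLeastAtMost' continuous_intros G s)
    \<comment> \<open>Integrability must be established: the integral of a function that is not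
      integrable is zero by convention, and its smallness would then say nothing.\<close>
    have intQ: "set_integrable lborel {0..1} (\<lambda>t. (norm (H t - G t))\<^sup>2 * s t)"
    proof (rule set_integrable_bound[OF _ measn[OF G(1)]])
      show "set_integrable lborel {0..1} (\<lambda>t. 2 * ((norm (H t))\<^sup>2 * s t) + 2 * ((norm (G t))\<^sup>2 * s t))"
        using H(2) intG2 by (intro set_integral_add set_integrable_mult_right)
      have "(norm (H t - G t))\<^sup>2 * s t \<le> 2 * ((norm (H t))\<^sup>2 * s t) + 2 * ((norm (G t))\<^sup>2 * s t)" for t
      proof -
        have "(norm (H t - G t))\<^sup>2 \<le> (norm (H t) + norm (G t))\<^sup>2"
          by (intro power_mono norm_triangle_ineq4) auto
        also have "\<dots> \<le> 2 * (norm (H t))\<^sup>2 + 2 * (norm (G t))\<^sup>2"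
          using zero_le_power2[of "norm (H t) - norm (G t)"] by (simp add: power2_eq_square algebra_simps)
        finally have "(norm (H t - G t))\<^sup>2 * s t \<le> (2 * (norm (H t))\<^sup>2 + 2 * (norm (G t))\<^sup>2) * s t"
          using s(2) by (intro mult_right_mono) auto
        thus ?thesis by (simp add: algebra_simps)
      qed
      thus "AE t in lborel. t \<in> {0..1} \<longrightarrow> norm ((norm (H t - G t))\<^sup>2 * s t) \<le>
          norm (2 * ((norm (H t))\<^sup>2 * s t) + 2 * ((norm (G t))\<^sup>2 * s t))"
        using s(2) by (intro AE_I2) (auto intro: order_trans[OF _ abs_ge_self])
    qed
    define b where "b = (\<lambda>t. r * \<delta> * s t + r / \<delta> * ((norm (H t - G t))\<^sup>2 * s t))"
    have intb: "set_integrable lborel {0..1} b"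
      unfolding b_def using ints intQ by (intro set_integral_add set_integrable_mult_right)
    have bound: "norm (\<phi> t * cnj (H t - G t) * of_real (s t)) \<le> b t" for t
    proof -
      define q where "q = norm (H t - G t)"
      have q: "q \<ge> 0" by (simp add: q_def)
      have "2 * (q * \<delta>) \<le> \<delta> * \<delta> + q * q"
        using zero_le_power2[of "q - \<delta>"] by (simp add: power2_eq_square algebra_simps)
      moreover have "0 \<le> q * \<delta>" using q \<delta> by simp
      ultimately have "q * \<delta> \<le> \<delta> * \<delta> + q * q" by linarith
      hence "q \<le> \<delta> + q\<^sup>2 / \<delta>" using \<delta> by (simp add: field_simps power2_eq_square)
      hence "norm (\<phi> t) * q \<le> r * (\<delta> + q\<^sup>2 / \<delta>)" using \<phi>(2) r q by (intro mult_mono) auto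
      hence "norm (\<phi> t) * q * s t \<le> r * (\<delta> + q\<^sup>2 / \<delta>) * s t" using s(2) by (intro mult_right_mono) auto
      moreover have "norm (\<phi> t * cnj (H t - G t) * of_real (s t)) = norm (\<phi> t) * q * s t"
        using s(2)[of t] by (simp only: norm_mult complex_mod_cnj norm_of_real q_def abs_of_nonneg)
      moreover have "b t = r * (\<delta> + q\<^sup>2 / \<delta>) * s t"
        by (simp add: b_def q_def algebra_simps)
      ultimately show ?thesis by simp
    qed
    have intd: "set_integrable lborel {0..1} (\<lambda>t. \<phi> t * cnj (H t - G t) * of_real (s t))"
    proof (rule set_integrable_bound[OF intb meas[OF \<phi>(1) G(1)]])
      show "AE t in lborel. t \<in> {0..1} \<longrightarrow> norm (\<phi> t * cnj (H t - G t) * of_real (s t)) \<le> norm (b t)"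
        using bound by (intro AE_I2 impI) (auto intro: order_trans[OF _ abs_ge_self])
    qed
    have intg: "set_integrable lborel {0..1} (\<lambda>t. \<phi> t * cnj (G t) * of_real (s t))"
      by (intro borel_integrable_atLeastAtMost' continuous_intros G s \<phi>)
    \<comment> \<open>The part with \<open>G\<close> integrates to zero by the choice of
      \<open>G\<close>, so only the error \<open>H - G\<close> remains to be estimated.\<close>
    have "I = (LINT t:{0..1}|lborel. \<phi> t * cnj (H t - G t) * of_real (s t) + \<phi> t * cnj (G t) * of_real (s t))"
      unfolding I_def by (simp add: algebra_simps)
    also have "\<dots> = (LINT t:{0..1}|lborel. \<phi> t * cnj (H t - G t) * of_real (s t))"
      using set_integral_add(2)[OF intd intg] G(2) by simp
    finally have "norm I \<le> (LINT t:{0..1}|lborel. norm (\<phi> t * cnj (H t - G t) * of_real (s t)))"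
      using set_integral_norm_bound[OF intd] by simp
    also have "\<dots> \<le> (LINT t:{0..1}|lborel. b t)"
      using set_integrable_norm[OF intd] intb bound by (intro set_integral_mono) auto
    also have "\<dots> = r * \<delta> * S + r / \<delta> * (LINT t:{0..1}|lborel. (norm (H t - G t))\<^sup>2 * s t)"
      unfolding b_def S_def using ints intQ by (subst set_integral_add) auto
    also have "\<dots> \<le> r * \<delta> * S + r / \<delta> * \<delta>\<^sup>2"
      using G(3) r \<delta> by (intro add_left_mono mult_left_mono) auto
    also have "\<dots> = \<delta> * (r * (S + 1))" using \<delta> by (simp add: power2_eq_square algebra_simps)
    finally show ?thesis .
  qed
  hence "\<forall>\<^sub>F \<delta> in at_right 0. norm I \<le> \<delta> * (r * (S + 1))"
    by (simp add: eventually_at_right_less eventually_at_filter)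
  moreover have "((\<lambda>\<delta>. \<delta> * (r * (S + 1))) \<longlongrightarrow> 0) (at_right 0)"
    by (auto intro!: tendsto_eq_intros)
  ultimately have "norm I \<le> 0"
    by (intro tendsto_lowerbound[of _ 0 "at_right 0"]) auto
  thus ?thesis by (simp add: I_def)
qed

text \<open>All summands are nonnegative. Thus one approximant for the whole boundary is good on
  each curve separately.\<close>

lemma bdry_norm_sq_ge_component:
  assumes "\<gamma> \<in> set \<gamma>s"
  shows "(LINT t:{0..1}|lborel. (norm (g (\<gamma> t)))\<^sup>2 * speed \<gamma> t) \<le> bdry_norm_sq \<gamma>s g"
proof -
  define J where "J = (\<lambda>\<gamma>. LINT t:{0..1}|lborel. (norm (g (\<gamma> t)))\<^sup>2 * speed \<gamma> t)"
  have J0: "J \<beta> \<ge> 0" for \<beta>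
    unfolding J_def set_lebesgue_integral_def by (intro Bochner_Integration.integral_nonneg) auto
  obtain xs ys where "\<gamma>s = xs @ \<gamma> # ys" using assms by (meson split_list)
  moreover have "sum_list (map J xs) \<ge> 0" "sum_list (map J ys) \<ge> 0"
    using J0 by (auto intro!: sum_list_nonneg)
  ultimately have "J \<gamma> \<le> sum_list (map J \<gamma>s)" by simp
  thus ?thesis by (simp add: J_def bdry_norm_sq_def)
qed

text \<open>Orthogonality is shown curve by curve: each boundary curve lies on the circle, Cauchy's
  theorem handles functions holomorphic in the disc and continuous up to its boundary, and L2
  approximation extends this to the Hardy space.\<close>

lemma ball_imp_szego_constant:
  assumes param: "analytic_boundary_param (ball z0 r) \<gamma>s" and r: "r > 0"
  shows "is_szego_projection (ball z0 r) \<gamma>s cnj (\<lambda>_. cnj z0)"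
  unfolding is_szego_projection_def
proof (intro conjI ballI)
  show "(\<lambda>_. cnj z0) \<in> hardy_space (ball z0 r) \<gamma>s"
    by (intro hardy_space_holomorphic[OF param] holomorphic_intros continuous_intros)
  fix h assume h: "h \<in> hardy_space (ball z0 r) \<gamma>s"
  have "(LINT t:{0..1}|lborel. (cnj (\<gamma> t) - cnj z0) * cnj (h (\<gamma> t)) * of_real (speed \<gamma> t)) = 0"
    if \<gamma>: "\<gamma> \<in> set \<gamma>s" for \<gamma>
  proof -
    note ajc = analytic_boundary_param_setD(1)[OF param \<gamma>]
    have on: "norm (\<gamma> t - z0) = r" for t
      using analytic_boundary_param_setD(2)[OF param \<gamma>, of t] r by (simp add: dist_norm norm_minus_commute)
    show ?thesis
    proof (rule set_integral_zero_L2_closure[where r = r])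
      show "continuous_on {0..1} (\<lambda>t. cnj (\<gamma> t) - cnj z0)" "continuous_on {0..1} (speed \<gamma>)"
        by (intro continuous_intros ajc)+
      show "norm (cnj (\<gamma> t) - cnj z0) \<le> r" for t
        using on[of t] by (metis complex_cnj_diff complex_mod_cnj order_refl)
      show "set_borel_measurable lborel {0..1} (\<lambda>t. h (\<gamma> t))"
        "set_integrable lborel {0..1} (\<lambda>t. (norm (h (\<gamma> t)))\<^sup>2 * speed \<gamma> t)"
        using h \<gamma> by (auto simp: hardy_space_def bdry_L2_def)
      fix e :: real assume "e > 0"
      then obtain F where F: "F holomorphic_on ball z0 r" "continuous_on (closure (ball z0 r)) F"
        "bdry_norm_sq \<gamma>s (\<lambda>z. h z - F z) < e"
        using h unfolding hardy_space_def by blast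
      have cont: "continuous_on {0..1} (\<lambda>t. F (\<gamma> t))"
        by (rule continuous_closure_compose_boundary[OF param \<gamma> F(2)])
      have "((\<lambda>t. (\<gamma> t - z0) * F (\<gamma> t) * complex_of_real (speed \<gamma> t)) has_integral 0) {0..1}"
        using F r by (intro circle_arclength_orthogonal_holomorphic[OF ajc on]) auto
      \<comment> \<open>Cauchy's theorem concerns \<open>(z - z0) * F z\<close>, while the inner
        product against \<open>F\<close> contains its complex conjugate.\<close>
      hence "((cnj \<circ> (\<lambda>t. (\<gamma> t - z0) * F (\<gamma> t) * complex_of_real (speed \<gamma> t))) has_integral cnj 0) {0..1}"
        by (intro has_integral_linear bounded_linear_cnj)
      hence "integral {0..1} (\<lambda>t. (cnj (\<gamma> t) - cnj z0) * cnj (F (\<gamma> t)) * complex_of_real (speed \<gamma> t)) = 0"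
        by (simp add: o_def integral_unique)
      moreover have "continuous_on {0..1} (\<lambda>t. (cnj (\<gamma> t) - cnj z0) * cnj (F (\<gamma> t)) * complex_of_real (speed \<gamma> t))"
        by (intro continuous_intros ajc cont)
      ultimately have "(LINT t:{0..1}|lborel. (cnj (\<gamma> t) - cnj z0) * cnj (F (\<gamma> t)) * complex_of_real (speed \<gamma> t)) = 0"
        using set_lebesgue_integral_continuous by metis
      moreover have "(LINT t:{0..1}|lborel. (norm (h (\<gamma> t) - F (\<gamma> t)))\<^sup>2 * speed \<gamma> t) < e"
        using bdry_norm_sq_ge_component[OF \<gamma>, of "\<lambda>z. h z - F z"] F(3) by linarith
      ultimately show "\<exists>G. continuous_on {0..1} G \<and>
        (LINT t:{0..1}|lborel. (cnj (\<gamma> t) - cnj z0) * cnj (G t) * of_real (speed \<gamma> t)) = 0 \<and>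
        (LINT t:{0..1}|lborel. (norm (h (\<gamma> t) - G t))\<^sup>2 * speed \<gamma> t) < e"
        using cont by blast
    qed simp
  qed
  thus "bdry_inner \<gamma>s (\<lambda>z. cnj z - cnj z0) h = 0"
    by (simp add: bdry_inner_def bdry_integral_def cong: map_cong)
qed

theorem theorem6:
  fixes \<Omega> :: "complex set" and \<gamma>s :: "(real \<Rightarrow> complex) list"
  assumes "bounded_domain \<Omega>"
    and "analytic_boundary_param \<Omega> \<gamma>s"
  shows "(\<exists>z0 r. r > 0 \<and> \<Omega> = ball z0 r) \<longleftrightarrow>
         (\<exists>c::complex. is_szego_projection \<Omega> \<gamma>s cnj (\<lambda>_. c))"
  using ball_imp_szego_constant szego_constant_imp_ball assms by blast

end
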